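(* Let $d\geq 1$ and $p\geq 1$ be integers, and let $(W,W',G)$ be a triple of $d$-dimensional random vectors forming a Stein coupling, i.e. $$\mathbb{E}\{G^t g(W')-G^t g(W)\}=\mathbb{E}\{W^t g(W)\}$$ for all $g:\mathbb{R}^d\to\mathbb{R}^d$ for which the expectations exist. Let $\Sigma=(\sigma_{ij})_{1\leq i,j\leq d}=\operatorname{Cov}(W)$, set $D=W'-W$, and let $Z$ be a centred Gaussian vector with covariance matrix $\Sigma$. Then, for any $(p+2)$-times differentiable function $h:\mathbb{R}^d\to\mathbb{R}$, $$|\mathbb{E}h(W)-\mathbb{E}h(Z)|\leq\sum_{i=1}^d\Bigg(\sum_{\alpha:1\leq|\alpha|\leq p}\frac{|h|_{\alpha+e_i}}{(|\alpha|+1)\alpha!}\sqrt{\operatorname{Var}\mathbb{E}\{G_iD^\alpha\mid W\}}+\sum_{\alpha:2\leq|\alpha|\leq p}\frac{|h|_{\alpha+e_i}}{(|\alpha|+1)\alpha!}\big|\mathbb{E}\{G_iD^\alpha\}\big|+\sum_{\alpha:|\alpha|=p+1}\frac{|h|_{\alpha+e_i}}{(p+2)\alpha!}\mathbb{E}|G_iD^\alpha|\Bigg).$$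
   Context: Sums are over multi-indices $\alpha=(\alpha_1,\dots,\alpha_d)$ of nonnegative integers; $|\alpha|=\alpha_1+\cdots+\alpha_d$, $\alpha!=\alpha_1!\cdots\alpha_d!$, $z^\alpha=z_1^{\alpha_1}\cdots z_d^{\alpha_d}$ (so $D^\alpha=D_1^{\alpha_1}\cdots D_d^{\alpha_d}$), $\partial^\alpha h=\partial^{|\alpha|}h/\partial x_1^{\alpha_1}\cdots\partial x_d^{\alpha_d}$, $|h|_\alpha=\sup_{x\in\mathbb{R}^d}|\partial^\alpha h(x)|$, and $e_i$ is the $i$-th unit vector. *)

theory Defs
  imports "HOL-Probability.Probability"
begin

definition partial :: "'d::finite \<Rightarrow> (real^'d \<Rightarrow> real) \<Rightarrow> real^'d \<Rightarrow> real" where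
  "partial i f x = deriv (\<lambda>t. f (x + t *\<^sub>R axis i 1)) 0"

fun partials :: "'d::finite list \<Rightarrow> (real^'d \<Rightarrow> real) \<Rightarrow> real^'d \<Rightarrow> real" where
  "partials [] f = f"
| "partials (i # is) f = partial i (partials is f)"

definition idx_list :: "'d::finite list" where
  "idx_list = (SOME xs. distinct xs \<and> set xs = UNIV)"

definition pderiv_mi :: "('d::finite \<Rightarrow> nat) \<Rightarrow> (real^'d \<Rightarrow> real) \<Rightarrow> real^'d \<Rightarrow> real" where
  "pderiv_mi \<alpha> f = partials (concat (map (\<lambda>i. replicate (\<alpha> i) i) idx_list)) f"

definition k_times_differentiable :: "nat \<Rightarrow> (real^'d::finite \<Rightarrow> real) \<Rightarrow> bool" where
  "k_times_differentiable k f \<longleftrightarrow>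
     (\<forall>is x. length is < k \<longrightarrow> partials is f differentiable (at x))"

definition mi_abs :: "('d::finite \<Rightarrow> nat) \<Rightarrow> nat" where
  "mi_abs \<alpha> = (\<Sum>i\<in>UNIV. \<alpha> i)"

definition mi_fact :: "('d::finite \<Rightarrow> nat) \<Rightarrow> real" where
  "mi_fact \<alpha> = (\<Prod>i\<in>UNIV. fact (\<alpha> i))"

definition mi_pow :: "real^'d::finite \<Rightarrow> ('d \<Rightarrow> nat) \<Rightarrow> real" where
  "mi_pow z \<alpha> = (\<Prod>i\<in>UNIV. (z $ i) ^ \<alpha> i)"

definition add_unit_mi :: "('d \<Rightarrow> nat) \<Rightarrow> 'd \<Rightarrow> 'd \<Rightarrow> nat" where
  "add_unit_mi \<alpha> i = (\<lambda>j. \<alpha> j + (if j = i then 1 else 0))"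

definition sup_norm_mi :: "(real^'d::finite \<Rightarrow> real) \<Rightarrow> ('d \<Rightarrow> nat) \<Rightarrow> real" where
  "sup_norm_mi h \<alpha> = (SUP x. \<bar>pderiv_mi \<alpha> h x\<bar>)"

definition Var :: "'a measure \<Rightarrow> ('a \<Rightarrow> real) \<Rightarrow> real" where
  "Var M X = (\<integral>x. (X x - (\<integral>y. X y \<partial>M))\<^sup>2 \<partial>M)"

definition cond_exp_given :: "'a measure \<Rightarrow> ('a \<Rightarrow> real^'d::finite) \<Rightarrow> ('a \<Rightarrow> real) \<Rightarrow> 'a \<Rightarrow> real" where
  "cond_exp_given M W X = real_cond_exp M (vimage_algebra (space M) W borel) X"

definition cov_matrix :: "'a measure \<Rightarrow> ('a \<Rightarrow> real^'d::finite) \<Rightarrow> real^'d^'d" where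
  "cov_matrix M W = (\<chi> i j. (\<integral>x. W x $ i * W x $ j \<partial>M)
                              - (\<integral>x. W x $ i \<partial>M) * (\<integral>x. W x $ j \<partial>M))"

definition centred_gaussian :: "'b measure \<Rightarrow> ('b \<Rightarrow> real^'d::finite) \<Rightarrow> real^'d^'d \<Rightarrow> bool" where
  "centred_gaussian N Z S \<longleftrightarrow> prob_space N \<and> Z \<in> borel_measurable N \<and>
     (\<forall>u. let q = u \<bullet> (S *v u) in
        distr N borel (\<lambda>w. u \<bullet> Z w) =
          (if q = 0 then return borel 0 else density lborel (normal_density 0 (sqrt q))))"

definition stein_coupling :: "'a measure \<Rightarrow> ('a \<Rightarrow> real^'d::finite) \<Rightarrow> ('a \<Rightarrow> real^'d)
     \<Rightarrow> ('a \<Rightarrow> real^'d) \<Rightarrow> bool" where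
  "stein_coupling M W W' G \<longleftrightarrow>
     (\<forall>g :: real^'d \<Rightarrow> real^'d. g \<in> borel_measurable borel \<longrightarrow>
        integrable M (\<lambda>x. G x \<bullet> g (W' x) - G x \<bullet> g (W x)) \<longrightarrow>
        integrable M (\<lambda>x. W x \<bullet> g (W x)) \<longrightarrow>
        (\<integral>x. G x \<bullet> g (W' x) - G x \<bullet> g (W x) \<partial>M) = (\<integral>x. W x \<bullet> g (W x) \<partial>M))"

end

theory Submission
  imports Defs
begin

text \<open>
  Interpolate along the quarter circle: \<open>\<phi> t = E h (sin t W + cos t Z)\<close>, with \<open>Z\<close> independent
  of \<open>(W, W', G)\<close>, runs from \<open>E h(Z)\<close> to \<open>E h(W)\<close>. In \<open>\<phi>' t\<close> the part containing \<open>W\<close> is rewritten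
  by the Stein coupling applied to \<open>g_i w = E (\<partial>_i h (sin t w + cos t Z))\<close> and expanded by
  Taylor's formula, and the part containing \<open>Z\<close> by Gaussian integration by parts. The Stein
  identity for constant and linear functions gives \<open>E W = 0\<close> and \<open>E (G_i D_j) = \<sigma>_ij\<close>, so the two
  second-order contributions cancel up to a conditional variance, and
  \<open>|\<phi>' t| \<le> \<Sum> c_\<alpha> sin^|\<alpha>| t cos t\<close>. Integrating over \<open>[0, \<pi>/2]\<close> yields the factors
  \<open>1 / (|\<alpha>| + 1)\<close>. Integration by parts itself follows from the rotation invariance of a pair of
  independent copies of \<open>Z\<close>, which in turn rests on the fact that a probability measure on a
  Euclidean space is determined by its trigonometric integrals.
\<close>

subsection \<open>Mixed partial derivatives and the multi-index Taylor formula\<close>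

text \<open>Three obstacles shape the proof. First, \<open>h\<close> is only differentiable, so
  derivatives of order p + 2 exist but may be discontinuous. Mixed partials therefore commute by
  Young's argument, from differentiability alone, and top-order derivatives are met only pointwise,
  in a Lagrange remainder that is bounded by its supremum before anything is integrated. Second,
  \<open>Z\<close> is given through the laws of its projections and its covariance may be singular,
  so there is no density against which to integrate by parts; the rotation argument covers
  degenerate directions as well. Third, \<open>h\<close> and its gradient are unbounded: bounds
  start at order 2, so \<open>h\<close> grows quadratically and the second moments of
  \<open>W\<close> must do all the domination. The quarter circle, unlike a path with square roots,
  has bounded speed up to both ends, so one dominating function serves for all t; and since
  \<open>cos t\<close> is the derivative of \<open>sin t\<close>, every term of the bound on the
  derivative has an explicit primitive.\<close>

lemma DERIV_line_frechet:
  fixes f :: "real^'d::finite \<Rightarrow> real"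
  assumes "f differentiable (at (y + t *\<^sub>R v))"
  shows "((\<lambda>t. f (y + t *\<^sub>R v)) has_real_derivative frechet_derivative f (at (y + t *\<^sub>R v)) v) (at t)"
proof -
  let ?D = "frechet_derivative f (at (y + t *\<^sub>R v))"
  have D: "(f has_derivative ?D) (at (y + t *\<^sub>R v))"
    using assms frechet_derivative_works by blast
  have "((\<lambda>t. y + t *\<^sub>R v) has_derivative (\<lambda>h. h *\<^sub>R v)) (at t)"
    by (auto intro!: derivative_eq_intros)
  from diff_chain_at[OF this D]
  have "((\<lambda>t. f (y + t *\<^sub>R v)) has_derivative (\<lambda>h. ?D (h *\<^sub>R v))) (at t)"
    by (simp add: o_def)
  moreover have "?D (h *\<^sub>R v) = ?D v * h" for h
    using linear_frechet_derivative[OF assms] by (simp add: linear_cmul)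
  ultimately show ?thesis
    unfolding has_field_derivative_def by (simp add: mult.commute[of _ "?D v"])
qed

lemma partial_eq_frechet:
  assumes "f differentiable (at x)"
  shows "partial i f x = frechet_derivative f (at x) (axis i 1)"
  using DERIV_line_frechet[of f x 0 "axis i 1"] assms
  unfolding partial_def by (auto intro: DERIV_imp_deriv)

lemma frechet_eq_sum_partial:
  fixes f :: "real^'d::finite \<Rightarrow> real"
  assumes "f differentiable (at x)"
  shows "frechet_derivative f (at x) v = (\<Sum>j\<in>UNIV. v $ j * partial j f x)"
proof -
  have lin: "linear (frechet_derivative f (at x))"
    using assms by (rule linear_frechet_derivative)
  have "frechet_derivative f (at x) v = frechet_derivative f (at x) (\<Sum>j\<in>UNIV. v $ j *\<^sub>R axis j 1)"
    using basis_expansion[of v] by (simp add: scalar_mult_eq_scaleR)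
  also have "\<dots> = (\<Sum>j\<in>UNIV. v $ j * partial j f x)"
    using lin by (simp add: linear_sum linear_cmul partial_eq_frechet[OF assms])
  finally show ?thesis .
qed

lemma DERIV_line:
  fixes f :: "real^'d::finite \<Rightarrow> real"
  assumes "f differentiable (at (y + t *\<^sub>R v))"
  shows "((\<lambda>t. f (y + t *\<^sub>R v)) has_real_derivative (\<Sum>j\<in>UNIV. v $ j * partial j f (y + t *\<^sub>R v))) (at t)"
  using DERIV_line_frechet[OF assms] frechet_eq_sum_partial[OF assms] by simp

text \<open>The mean value theorem, used in direction \<open>i\<close> alone, turns the second
  difference into an increment of \<open>partial i f\<close>, so besides \<open>f\<close> only that
  one function has to be differentiable, and only at \<open>x\<close>. The quotient itself is
  symmetric in \<open>i\<close> and \<open>j\<close>.\<close>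

lemma mixed_partial_limit:
  fixes f :: "real^'d::finite \<Rightarrow> real"
  assumes f: "\<And>x. f differentiable (at x)" and fi: "partial i f differentiable (at x)"
  shows "((\<lambda>t. (f (x + t *\<^sub>R axis i 1 + t *\<^sub>R axis j 1) - f (x + t *\<^sub>R axis i 1)
              - f (x + t *\<^sub>R axis j 1) + f x) / t\<^sup>2) \<longlongrightarrow> partial j (partial i f) x) (at_right 0)"
proof (rule tendstoI)
  fix e :: real assume e: "e > 0"
  define a where "a = (axis i 1 :: real^'d)"
  define b where "b = (axis j 1 :: real^'d)"
  have [simp]: "norm a = 1" "norm b = 1" by (auto simp: a_def b_def norm_axis_1)
  let ?g = "partial i f"
  let ?L = "frechet_derivative ?g (at x)"
  have gd: "(?g has_derivative ?L) (at x)"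
    using fi frechet_derivative_works by blast
  have lin: "linear ?L" using fi by (rule linear_frechet_derivative)
  have Lb: "?L b = partial j ?g x" unfolding b_def using partial_eq_frechet[OF fi] by simp
  \<comment> \<open>The factor \<open>e/4\<close> leaves room: the two points used below lie within
    \<open>2 * t\<close> and \<open>t\<close> of \<open>x\<close>, and the errors add up to
    \<open>3/4 * e * t\<close>.\<close>
  from gd[unfolded has_derivative_at_alt] e
  obtain d where d: "d > 0" "\<And>y. norm (y - x) < d \<Longrightarrow> norm (?g y - ?g x - ?L (y - x)) \<le> (e/4) * norm (y - x)"
    by (metis zero_less_divide_iff zero_less_numeral)
  let ?\<Delta> = "\<lambda>t. f (x + t *\<^sub>R a + t *\<^sub>R b) - f (x + t *\<^sub>R a) - f (x + t *\<^sub>R b) + f x"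
  have main: "dist (?\<Delta> t / t\<^sup>2) (partial j ?g x) < e" if t: "0 < t" "t < d/2" for t
  proof -
    \<comment> \<open>The increment in direction \<open>j\<close> as a function of the step in
      direction \<open>i\<close>; its change over \<open>[0, t]\<close> is the second
      difference.\<close>
    let ?q = "\<lambda>r. f ((x + t *\<^sub>R b) + r *\<^sub>R a) - f (x + r *\<^sub>R a)"
    have der: "(?q has_real_derivative (?g ((x + t *\<^sub>R b) + r *\<^sub>R a) - ?g (x + r *\<^sub>R a))) (at r)" for r
      using DERIV_diff[OF DERIV_line_frechet[where f=f and y="x + t *\<^sub>R b" and t=r and v=a, OF f]
          DERIV_line_frechet[where f=f and y=x and t=r and v=a, OF f]]
      by (simp add: partial_eq_frechet[OF f] a_def)
    obtain r where r: "0 < r" "r < t" "?q t - ?q 0 = (t - 0) * (?g ((x + t *\<^sub>R b) + r *\<^sub>R a) - ?g (x + r *\<^sub>R a))"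
      using MVT2[OF t(1), of ?q "\<lambda>r. ?g ((x + t *\<^sub>R b) + r *\<^sub>R a) - ?g (x + r *\<^sub>R a)"] der by blast
    have D: "?\<Delta> t = t * (?g ((x + t *\<^sub>R b) + r *\<^sub>R a) - ?g (x + r *\<^sub>R a))"
      using r(3) by (simp add: algebra_simps)
    have n1: "norm ((x + t *\<^sub>R b) + r *\<^sub>R a - x) \<le> 2 * t"
      using norm_triangle_ineq[of "t *\<^sub>R b" "r *\<^sub>R a"] r t by (simp add: algebra_simps)
    have n2: "norm (x + r *\<^sub>R a - x) \<le> t" using r t by simp
    have e1: "\<bar>?g ((x + t *\<^sub>R b) + r *\<^sub>R a) - ?g x - (t * ?L b + r * ?L a)\<bar> \<le> e/4 * (2 * t)"
    proof -
      have "?L (x + t *\<^sub>R b + r *\<^sub>R a - x) = t * ?L b + r * ?L a"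
        using lin by (simp add: linear_add linear_cmul)
      moreover have "norm (?g ((x + t *\<^sub>R b) + r *\<^sub>R a) - ?g x - ?L (x + t *\<^sub>R b + r *\<^sub>R a - x)) \<le> e/4 * (2 * t)"
        by (rule order_trans[OF d(2) mult_left_mono[OF n1]]) (use n1 t e in auto)
      ultimately show ?thesis by (simp only: real_norm_def)
    qed
    have e2: "\<bar>?g (x + r *\<^sub>R a) - ?g x - r * ?L a\<bar> \<le> e/4 * t"
    proof -
      have "?L (x + r *\<^sub>R a - x) = r * ?L a"
        using lin by (simp add: linear_cmul)
      moreover have "norm (?g (x + r *\<^sub>R a) - ?g x - ?L (x + r *\<^sub>R a - x)) \<le> e/4 * t"
        by (rule order_trans[OF d(2) mult_left_mono[OF n2]]) (use n2 t e in auto)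
      ultimately show ?thesis by (simp only: real_norm_def)
    qed
    have "\<bar>?\<Delta> t - t\<^sup>2 * ?L b\<bar> = t * \<bar>(?g ((x + t *\<^sub>R b) + r *\<^sub>R a) - ?g (x + r *\<^sub>R a)) - t * ?L b\<bar>"
    proof -
      have "?\<Delta> t - t\<^sup>2 * ?L b = t * ((?g ((x + t *\<^sub>R b) + r *\<^sub>R a) - ?g (x + r *\<^sub>R a)) - t * ?L b)"
        unfolding D by (simp add: algebra_simps power2_eq_square)
      then show ?thesis using t by (simp add: abs_mult)
    qed
    also have "\<dots> \<le> t * (3/4 * e * t)"
    proof (rule mult_left_mono)
      have "e/4 * (2 * t) + e/4 * t = 3/4 * e * t" by simp
      then show "\<bar>(?g ((x + t *\<^sub>R b) + r *\<^sub>R a) - ?g (x + r *\<^sub>R a)) - t * ?L b\<bar> \<le> 3/4 * e * t"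
        using e1 e2 by linarith
    qed (use t in simp)
    also have "\<dots> < e * t\<^sup>2" using e t by (simp add: power2_eq_square)
    finally have "\<bar>?\<Delta> t - t\<^sup>2 * ?L b\<bar> / t\<^sup>2 < e" using t by (simp add: field_simps)
    moreover have "?\<Delta> t / t\<^sup>2 - ?L b = (?\<Delta> t - t\<^sup>2 * ?L b) / t\<^sup>2"
      using t by (simp add: diff_divide_distrib)
    ultimately show ?thesis by (simp add: dist_real_def Lb)
  qed
  show "\<forall>\<^sub>F t in at_right 0. dist ((f (x + t *\<^sub>R axis i 1 + t *\<^sub>R axis j 1) - f (x + t *\<^sub>R axis i 1)
              - f (x + t *\<^sub>R axis j 1) + f x) / t\<^sup>2) (partial j ?g x) < e"
    unfolding a_def[symmetric] b_def[symmetric] eventually_at_right_field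
    using main d(1) by (intro exI[of _ "d/2"]) auto
qed

text \<open>Young's theorem: both sides are limits of one and the same quotient, so no continuity of
  second derivatives enters.\<close>

lemma partial_commute:
  fixes f :: "real^'d::finite \<Rightarrow> real"
  assumes f: "\<And>x. f differentiable (at x)"
    and "partial i f differentiable (at x)" "partial j f differentiable (at x)"
  shows "partial i (partial j f) x = partial j (partial i f) x"
proof (rule tendsto_unique)
  show "((\<lambda>t. (f (x + t *\<^sub>R axis i 1 + t *\<^sub>R axis j 1) - f (x + t *\<^sub>R axis i 1)
              - f (x + t *\<^sub>R axis j 1) + f x) / t\<^sup>2) \<longlongrightarrow> partial i (partial j f) x) (at_right 0)"
    using mixed_partial_limit[OF f assms(3), of i]
    by (simp add: add.commute add.left_commute diff_diff_eq)
  show "((\<lambda>t. (f (x + t *\<^sub>R axis i 1 + t *\<^sub>R axis j 1) - f (x + t *\<^sub>R axis i 1)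
              - f (x + t *\<^sub>R axis j 1) + f x) / t\<^sup>2) \<longlongrightarrow> partial j (partial i f) x) (at_right 0)"
    using mixed_partial_limit[OF f assms(2), of j] .
qed simp

lemma partials_append: "partials (xs @ ys) f = partials xs (partials ys f)"
  by (induction xs) auto

lemma k_times_differentiable_partials:
  assumes "k_times_differentiable (k + length xs) f"
  shows "k_times_differentiable k (partials xs f)"
  using assms unfolding k_times_differentiable_def
  by (auto simp: partials_append[symmetric] simp del: length_append simp add: length_append)

lemma k_times_differentiable_mono:
  "k_times_differentiable k f \<Longrightarrow> m \<le> k \<Longrightarrow> k_times_differentiable m f"
  unfolding k_times_differentiable_def by auto

text \<open>\<open>partials\<close> applies the head of the list last, so the appended
  \<open>i\<close> is the derivative taken first. It moves outwards past one index at a time; the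
  order of differentiability is exactly what the last exchange requires.\<close>

lemma partials_snoc:
  assumes "k_times_differentiable (Suc (length xs)) f"
  shows "partials (xs @ [i]) f = partials (i # xs) f"
  using assms
proof (induction xs)
  case (Cons j xs)
  have k: "\<And>is x. length is < Suc (Suc (length xs)) \<Longrightarrow> partials is f differentiable (at x)"
    using Cons.prems unfolding k_times_differentiable_def by auto
  have "partials ((j # xs) @ [i]) f = partial j (partials (i # xs) f)"
    using Cons.IH k_times_differentiable_mono[OF Cons.prems] by simp
  also have "\<dots> = partial j (partial i (partials xs f))" by simp
  also have "\<dots> = partial i (partial j (partials xs f))"
  proof
    fix x
    show "partial j (partial i (partials xs f)) x = partial i (partial j (partials xs f)) x"
      using k[of xs] k[of "i # xs"] k[of "j # xs"] by (intro partial_commute) auto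
  qed
  finally show ?case by simp
qed simp

text \<open>Induction on the first list: an occurrence of its head in the second list is brought to
  the front by \<open>partials_snoc\<close> and then cancelled.\<close>

lemma partials_mset:
  assumes "k_times_differentiable (length xs) f" "mset xs = mset ys"
  shows "partials xs f = partials ys f"
  using assms
proof (induction xs arbitrary: ys)
  case (Cons i xs)
  from Cons.prems(2) have "i \<in> set ys" by (metis list.set_intros(1) mset_eq_setD)
  then obtain y1 y2 where ys: "ys = y1 @ i # y2" by (meson split_list)
  with Cons.prems have m: "mset xs = mset (y1 @ y2)" by simp
  have len: "length xs = length y1 + length y2" using mset_eq_length[OF m] by simp
  have "partials ys f = partials (y1 @ [i]) (partials y2 f)" by (simp add: ys partials_append)
  also have "\<dots> = partials (i # y1) (partials y2 f)"
    using Cons.prems(1) len by (intro partials_snoc k_times_differentiable_partials) simp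
  also have "\<dots> = partial i (partials (y1 @ y2) f)" by (simp add: partials_append)
  also have "partials (y1 @ y2) f = partials xs f"
    using Cons.IH[OF k_times_differentiable_mono[OF Cons.prems(1)] m] by simp
  finally show ?case by simp
qed simp

section \<open>Multi-indices as lists of directions\<close>

definition mi_list :: "('d::finite \<Rightarrow> nat) \<Rightarrow> 'd list" where
  "mi_list \<alpha> = concat (map (\<lambda>i. replicate (\<alpha> i) i) idx_list)"

lemma pderiv_mi_eq: "pderiv_mi \<alpha> f = partials (mi_list \<alpha>) f"
  by (simp add: pderiv_mi_def mi_list_def)

lemma idx_list: "distinct (idx_list :: 'd::finite list)" "set (idx_list :: 'd list) = UNIV"
proof -
  have "\<exists>xs::'d list. distinct xs \<and> set xs = UNIV"
    using finite_distinct_list[of "UNIV :: 'd set"] by auto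
  then show "distinct (idx_list :: 'd::finite list)" "set (idx_list :: 'd list) = UNIV"
    unfolding idx_list_def by (metis (mono_tags, lifting) someI_ex)+
qed

lemma count_mi_list:
  fixes i :: "'d::finite"
  shows "count (mset (mi_list \<alpha>)) i = \<alpha> i"
proof -
  have "distinct xs \<Longrightarrow> count (mset (concat (map (\<lambda>i. replicate (\<alpha> i) i) xs))) i
      = (if i \<in> set xs then \<alpha> i else 0)" for xs
    by (induction xs) auto
  from this[of idx_list] show ?thesis
    unfolding mi_list_def using idx_list[where 'd='d] by simp
qed

lemma length_mi_list: "length (mi_list \<alpha>) = mi_abs \<alpha>"
proof -
  have "length (concat (map (\<lambda>i. replicate (\<alpha> i) i) xs)) = sum_list (map \<alpha> xs)" for xs
    by (induction xs) auto
  then show ?thesis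
    unfolding mi_list_def mi_abs_def using idx_list by (metis sum.distinct_set_conv_list)
qed

text \<open>The new \<open>i\<close> lands in the block prescribed by \<open>idx_list\<close>, not
  at the head, so the two lists agree only as multisets. With \<open>partials_mset\<close> this is
  enough.\<close>

lemma mset_mi_list_add_unit: "mset (mi_list (add_unit_mi \<alpha> i)) = mset (i # mi_list \<alpha>)"
  by (rule multiset_eqI) (auto simp: count_mi_list add_unit_mi_def)

lemma mi_abs_add_unit [simp]: "mi_abs (add_unit_mi \<alpha> i) = Suc (mi_abs \<alpha>)"
  by (simp add: mi_abs_def add_unit_mi_def sum.distrib)

lemma partial_pderiv_mi:
  assumes "k_times_differentiable (Suc (mi_abs \<alpha>)) f"
  shows "partial i (pderiv_mi \<alpha> f) = pderiv_mi (add_unit_mi \<alpha> i) f"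
  using partials_mset[OF _ mset_mi_list_add_unit, of \<alpha> i f] assms
  by (simp add: pderiv_mi_eq length_mi_list)

text \<open>Here the extra derivative is the innermost one. Taylor's formula will be applied to
  \<open>partial i h\<close>, and this rewrites its coefficients as derivatives of \<open>h\<close>
  itself.\<close>

lemma pderiv_mi_partial:
  assumes "k_times_differentiable (Suc (mi_abs \<alpha>)) f"
  shows "pderiv_mi \<alpha> (partial i f) = pderiv_mi (add_unit_mi \<alpha> i) f"
proof -
  have "pderiv_mi \<alpha> (partial i f) = partials (mi_list \<alpha> @ [i]) f"
    by (simp add: pderiv_mi_eq partials_append)
  also have "\<dots> = partials (mi_list (add_unit_mi \<alpha> i)) f"
    using assms by (intro partials_mset) (auto simp: length_mi_list mset_mi_list_add_unit)
  finally show ?thesis by (simp add: pderiv_mi_eq)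
qed

lemma pderiv_mi_differentiable:
  assumes "k_times_differentiable k f" "mi_abs \<alpha> < k"
  shows "pderiv_mi \<alpha> f differentiable (at x)"
  using assms unfolding k_times_differentiable_def pderiv_mi_eq by (simp add: length_mi_list)

section \<open>Multi-index arithmetic and Taylor's formula\<close>

lemma mi_pow_add_unit: "mi_pow v (add_unit_mi \<alpha> j) = v $ j * mi_pow v \<alpha>"
proof -
  have "mi_pow v (add_unit_mi \<alpha> j) = (\<Prod>i\<in>UNIV. v $ i ^ \<alpha> i) * (\<Prod>i\<in>UNIV. if i = j then v $ i else 1)"
    unfolding mi_pow_def add_unit_mi_def prod.distrib[symmetric]
    by (intro prod.cong) auto
  then show ?thesis by (simp add: mi_pow_def)
qed

lemma mi_fact_add_unit: "mi_fact (add_unit_mi \<alpha> j) = (real (\<alpha> j) + 1) * mi_fact \<alpha>"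
proof -
  have "mi_fact (add_unit_mi \<alpha> j) = (\<Prod>i\<in>UNIV. (fact (\<alpha> i) :: real)) * (\<Prod>i\<in>UNIV. if i = j then real (\<alpha> i) + 1 else 1)"
    unfolding mi_fact_def add_unit_mi_def prod.distrib[symmetric]
    by (intro prod.cong) auto
  then show ?thesis by (simp add: mi_fact_def)
qed

lemma mi_fact_pos [simp]: "mi_fact \<alpha> > 0"
  unfolding mi_fact_def by (intro prod_pos) auto

lemma finite_mi_le: "finite {\<alpha> :: 'd::finite \<Rightarrow> nat. mi_abs \<alpha> \<le> k}"
proof (rule finite_subset)
  show "{\<alpha> :: 'd \<Rightarrow> nat. mi_abs \<alpha> \<le> k} \<subseteq> PiE UNIV (\<lambda>_. {..k})"
  proof
    fix \<alpha> :: "'d \<Rightarrow> nat" assume "\<alpha> \<in> {\<alpha>. mi_abs \<alpha> \<le> k}"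
    moreover have "\<alpha> i \<le> mi_abs \<alpha>" for i
      unfolding mi_abs_def by (intro member_le_sum) auto
    ultimately show "\<alpha> \<in> PiE UNIV (\<lambda>_. {..k})"
      by (auto simp: PiE_def intro: order_trans)
  qed
qed (auto intro: finite_PiE)

lemma finite_mi [simp]: "finite {\<alpha> :: 'd::finite \<Rightarrow> nat. mi_abs \<alpha> = k}"
  by (rule finite_subset[OF _ finite_mi_le[of k]]) auto

lemma finite_mi_between [simp]: "finite {\<alpha> :: 'd::finite \<Rightarrow> nat. a \<le> mi_abs \<alpha> \<and> mi_abs \<alpha> \<le> k}"
  by (rule finite_subset[OF _ finite_mi_le[of k]]) auto

lemma mi_abs_eq_0: "mi_abs \<alpha> = 0 \<longleftrightarrow> \<alpha> = (\<lambda>_. 0)"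
  by (auto simp: mi_abs_def fun_eq_iff)

text \<open>Double counting: the pairs \<open>(\<alpha>, j)\<close> are collected by \<beta> =
  \<alpha> + e_j. As \<beta>! = \<beta>_j \<alpha>!, such a pair contributes
  \<open>\<beta> j\<close> times \<open>F \<beta> / mi_fact \<beta>\<close>, and the entries of
  \<beta> add up to \<open>k + 1\<close>.\<close>

lemma sum_mi_Suc:
  fixes F :: "('d::finite \<Rightarrow> nat) \<Rightarrow> real"
  shows "(\<Sum>\<alpha>\<in>{\<alpha>. mi_abs \<alpha> = k}. \<Sum>j\<in>UNIV. F (add_unit_mi \<alpha> j) / mi_fact \<alpha>)
       = (real k + 1) * (\<Sum>\<beta>\<in>{\<beta>. mi_abs \<beta> = Suc k}. F \<beta> / mi_fact \<beta>)"
proof -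
  have "(\<Sum>\<alpha>\<in>{\<alpha>. mi_abs \<alpha> = k}. \<Sum>j\<in>UNIV. F (add_unit_mi \<alpha> j) / mi_fact \<alpha>)
      = (\<Sum>(\<alpha>,j)\<in>{\<alpha>. mi_abs \<alpha> = k} \<times> UNIV. F (add_unit_mi \<alpha> j) / mi_fact \<alpha>)"
    by (simp add: sum.cartesian_product)
  \<comment> \<open>A pair with \<open>\<beta> j = 0\<close> does not arise by adding a unit in
    direction \<open>j\<close>; leaving such pairs out makes the map a bijection.\<close>
  also have "\<dots> = (\<Sum>(\<beta>,j)\<in>Sigma {\<beta>. mi_abs \<beta> = Suc k} (\<lambda>\<beta>. {j. \<beta> j > 0}). real (\<beta> j) * (F \<beta> / mi_fact \<beta>))"
  proof (rule sum.reindex_bij_witness[where i = "\<lambda>(\<beta>,j). (\<beta>(j := \<beta> j - 1), j)"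
        and j = "\<lambda>(\<alpha>,j). (add_unit_mi \<alpha> j, j)"], goal_cases)
    case (3 b)
    then obtain \<beta> j where b: "b = (\<beta>, j)" "\<beta> j > 0" "mi_abs \<beta> = Suc k" by auto
    have "add_unit_mi (\<beta>(j := \<beta> j - 1)) j = \<beta>"
      using b(2) by (auto simp: add_unit_mi_def fun_eq_iff)
    then show ?case using b by simp
  next
    case (4 b)
    then obtain \<beta> j where b: "b = (\<beta>, j)" "\<beta> j > 0" "mi_abs \<beta> = Suc k" by auto
    have "add_unit_mi (\<beta>(j := \<beta> j - 1)) j = \<beta>"
      using b(2) by (auto simp: add_unit_mi_def fun_eq_iff)
    then have "Suc (mi_abs (\<beta>(j := \<beta> j - 1))) = mi_abs \<beta>" by (metis mi_abs_add_unit)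
    then show ?case using b by simp
  next
    case (5 a)
    then obtain \<alpha> j where a: "a = (\<alpha>, j)" by (cases a)
    have "real (\<alpha> j) + 1 \<noteq> 0" by simp
    moreover have "real (add_unit_mi \<alpha> j j) = real (\<alpha> j) + 1" by (simp add: add_unit_mi_def)
    ultimately show ?case
      by (simp only: a mi_fact_add_unit prod.case times_divide_eq_right) (rule mult_divide_mult_cancel_left)
  qed (auto simp: add_unit_mi_def fun_eq_iff mi_abs_add_unit[unfolded add_unit_mi_def])
  also have "\<dots> = (\<Sum>\<beta>\<in>{\<beta>. mi_abs \<beta> = Suc k}. \<Sum>j\<in>{j. \<beta> j > 0}. real (\<beta> j) * (F \<beta> / mi_fact \<beta>))"
    by (subst sum.Sigma) auto
  also have "\<dots> = (\<Sum>\<beta>\<in>{\<beta>. mi_abs \<beta> = Suc k}. (real k + 1) * (F \<beta> / mi_fact \<beta>))"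
  proof (rule sum.cong[OF refl], goal_cases)
    case (1 \<beta>)
    have "(\<Sum>j\<in>{j. \<beta> j > 0}. real (\<beta> j)) = (\<Sum>j\<in>UNIV. real (\<beta> j))"
      by (rule sum.mono_neutral_left) auto
    also have "\<dots> = real k + 1" using 1 by (simp add: mi_abs_def flip: of_nat_sum)
    finally show ?case by (simp flip: sum_distrib_right add: sum_divide_distrib[symmetric])
  qed
  finally show ?thesis by (simp add: sum_distrib_left)
qed

text \<open>The chain rule followed by \<open>sum_mi_Suc\<close>. The factor \<open>k + 1\<close>
  makes \<open>fact k\<close> times the sum the \<open>k\<close>-th derivative of \<open>f\<close>
  along the line.\<close>

lemma mi_taylor_coeff_deriv:
  fixes f :: "real^'d::finite \<Rightarrow> real"
  assumes "k_times_differentiable (Suc k) f"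
  shows "((\<lambda>t. \<Sum>\<alpha>\<in>{\<alpha>. mi_abs \<alpha> = k}. mi_pow v \<alpha> * pderiv_mi \<alpha> f (y + t *\<^sub>R v) / mi_fact \<alpha>)
    has_real_derivative
    ((real k + 1) * (\<Sum>\<alpha>\<in>{\<alpha>. mi_abs \<alpha> = Suc k}. mi_pow v \<alpha> * pderiv_mi \<alpha> f (y + t *\<^sub>R v) / mi_fact \<alpha>))) (at t)"
proof -
  have "((\<lambda>t. mi_pow v \<alpha> * pderiv_mi \<alpha> f (y + t *\<^sub>R v) / mi_fact \<alpha>) has_real_derivative
       (\<Sum>j\<in>UNIV. mi_pow v (add_unit_mi \<alpha> j) * pderiv_mi (add_unit_mi \<alpha> j) f (y + t *\<^sub>R v) / mi_fact \<alpha>)) (at t)"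
    if \<alpha>: "mi_abs \<alpha> = k" for \<alpha>
  proof -
    have "((\<lambda>t. pderiv_mi \<alpha> f (y + t *\<^sub>R v)) has_real_derivative
        (\<Sum>j\<in>UNIV. v $ j * partial j (pderiv_mi \<alpha> f) (y + t *\<^sub>R v))) (at t)"
      using \<alpha> by (intro DERIV_line pderiv_mi_differentiable[OF assms]) auto
    from DERIV_cdivide[OF DERIV_cmult[OF this, of "mi_pow v \<alpha>"], of "mi_fact \<alpha>"]
    show ?thesis
      using \<alpha> assms
      by (simp add: partial_pderiv_mi mi_pow_add_unit sum_distrib_left sum_divide_distrib mult_ac)
  qed
  then have "((\<lambda>t. \<Sum>\<alpha>\<in>{\<alpha>. mi_abs \<alpha> = k}. mi_pow v \<alpha> * pderiv_mi \<alpha> f (y + t *\<^sub>R v) / mi_fact \<alpha>) has_real_derivative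
      (\<Sum>\<alpha>\<in>{\<alpha>. mi_abs \<alpha> = k}. \<Sum>j\<in>UNIV. mi_pow v (add_unit_mi \<alpha> j) * pderiv_mi (add_unit_mi \<alpha> j) f (y + t *\<^sub>R v) / mi_fact \<alpha>)) (at t)"
    by (intro DERIV_sum) auto
  then show ?thesis
    using sum_mi_Suc[of "\<lambda>\<alpha>. mi_pow v \<alpha> * pderiv_mi \<alpha> f (y + t *\<^sub>R v)" k] by simp
qed

lemma Collect_mi_abs_eq_0 [simp]: "{\<alpha>. mi_abs \<alpha> = 0} = {\<lambda>_. 0}"
  by (auto simp: mi_abs_eq_0)

lemma mi_list_0: "mi_list (\<lambda>_. 0) = []"
  using length_mi_list[of "\<lambda>_. 0"] by (simp add: mi_abs_def)

text \<open>Maclaurin's formula for \<open>f (y + t *\<^sub>R v)\<close> at \<open>t = 1\<close>.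
  Its remainder is of Lagrange type, so the top derivatives need only exist, and one point \<xi>
  serves all multi-indices of order \<open>p + 1\<close>.\<close>

theorem mi_taylor:
  fixes f :: "real^'d::finite \<Rightarrow> real"
  assumes "k_times_differentiable (Suc p) f"
  obtains \<xi> where "f (y + v) = f y
     + (\<Sum>\<alpha>\<in>{\<alpha>. 1 \<le> mi_abs \<alpha> \<and> mi_abs \<alpha> \<le> p}. mi_pow v \<alpha> * pderiv_mi \<alpha> f y / mi_fact \<alpha>)
     + (\<Sum>\<alpha>\<in>{\<alpha>. mi_abs \<alpha> = Suc p}. mi_pow v \<alpha> * pderiv_mi \<alpha> f \<xi> / mi_fact \<alpha>)"
proof -
  define T where "T k t = (\<Sum>\<alpha>\<in>{\<alpha>. mi_abs \<alpha> = k}. mi_pow v \<alpha> * pderiv_mi \<alpha> f (y + t *\<^sub>R v) / mi_fact \<alpha>)" for k t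
  define u where "u k t = fact k * T k t" for k t
  have T0: "T 0 t = f (y + t *\<^sub>R v)" for t
    by (simp add: T_def mi_pow_def mi_fact_def pderiv_mi_eq mi_list_0)
  have der: "(u k has_real_derivative u (Suc k) t) (at t)" if "k < Suc p" for k t
  proof -
    have "k_times_differentiable (Suc k) f" using k_times_differentiable_mono[OF assms] that by auto
    from DERIV_cmult[OF mi_taylor_coeff_deriv[OF this, of v y t], of "fact k"]
    show ?thesis unfolding u_def T_def by (simp add: algebra_simps)
  qed
  obtain s where s: "0 < s" "s < 1" "u 0 1 = (\<Sum>m<Suc p. u m 0 / fact m * 1 ^ m) + u (Suc p) s / fact (Suc p) * 1 ^ Suc p"
    using Maclaurin[of 1 "Suc p" u "u 0"] der by auto
  have "f (y + v) = (\<Sum>m<Suc p. T m 0) + T (Suc p) s"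
    using s(3) by (simp add: u_def T0 del: fact_Suc)
  also have "(\<Sum>m<Suc p. T m 0) = f y + (\<Sum>m\<in>{1..p}. T m 0)"
    by (subst sum.lessThan_Suc_shift) (simp add: T0 sum.atLeast1_atMost_eq)
  also have "(\<Sum>m\<in>{1..p}. T m 0) = (\<Sum>\<alpha>\<in>{\<alpha>. 1 \<le> mi_abs \<alpha> \<and> mi_abs \<alpha> \<le> p}. mi_pow v \<alpha> * pderiv_mi \<alpha> f y / mi_fact \<alpha>)"
  proof -
    have "(\<Sum>m\<in>{1..p}. T m 0) = (\<Sum>m\<in>{1..p}. \<Sum>\<alpha>\<in>{\<alpha>\<in>{\<alpha>. 1 \<le> mi_abs \<alpha> \<and> mi_abs \<alpha> \<le> p}. mi_abs \<alpha> = m}. mi_pow v \<alpha> * pderiv_mi \<alpha> f y / mi_fact \<alpha>)"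
      by (intro sum.cong) (auto simp: T_def intro!: sum.cong)
    also have "\<dots> = (\<Sum>\<alpha>\<in>{\<alpha>. 1 \<le> mi_abs \<alpha> \<and> mi_abs \<alpha> \<le> p}. mi_pow v \<alpha> * pderiv_mi \<alpha> f y / mi_fact \<alpha>)"
      by (rule sum.group) auto
    finally show ?thesis .
  qed
  finally show ?thesis using that[of "y + s *\<^sub>R v"] unfolding T_def by (simp add: add.assoc)
qed

lemma pderiv_mi_zero: "pderiv_mi (\<lambda>_. 0) f = f"
  by (simp add: pderiv_mi_eq mi_list_0)

lemma mi_abs_const_0 [simp]: "mi_abs (\<lambda>_. 0) = 0"
  by (simp add: mi_abs_def)

lemma pderiv_mi_unit:
  assumes "k_times_differentiable 1 f"
  shows "pderiv_mi (add_unit_mi (\<lambda>_. 0) j) f = partial j f"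
  using partial_pderiv_mi[of "\<lambda>_. 0" f j] assms by (simp add: pderiv_mi_zero)

lemma k_times_differentiable_partial:
  "k_times_differentiable (Suc k) f \<Longrightarrow> k_times_differentiable k (partial i f)"
  using k_times_differentiable_partials[of k "[i]" f] by simp

lemma mi_pow_scaleR: "mi_pow (s *\<^sub>R v) \<alpha> = s ^ mi_abs \<alpha> * mi_pow v \<alpha>"
  by (simp add: mi_pow_def mi_abs_def power_mult_distrib prod.distrib power_sum)

subsection \<open>Probability measures determined by trigonometric integrals\<close>

text \<open>Weighting by the nonnegative function 1 + r/2 keeps the measures positive, so that the
  one-dimensional uniqueness theorem applies.\<close>

lemma weighted_slab_eq:
  fixes M N :: "'a::euclidean_space measure" and r :: "'a \<Rightarrow> real"
  assumes M: "prob_space M" and N: "prob_space N" and sM [measurable_cong]: "sets M = sets borel"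
    and sN [measurable_cong]: "sets N = sets borel"
    and r [measurable]: "r \<in> borel_measurable borel" and r1: "\<And>x. \<bar>r x\<bar> \<le> 1"
    and eq1: "\<And>t a. (\<integral>x. cos (t * (x \<bullet> b) + a) \<partial>M) = (\<integral>x. cos (t * (x \<bullet> b) + a) \<partial>N)"
    and eq2: "\<And>t a. (\<integral>x. r x * cos (t * (x \<bullet> b) + a) \<partial>M) = (\<integral>x. r x * cos (t * (x \<bullet> b) + a) \<partial>N)"
    and A [measurable]: "A \<in> sets borel"
  shows "(\<integral>x. (1 + r x / 2) * indicator A (x \<bullet> b) \<partial>M) = (\<integral>x. (1 + r x / 2) * indicator A (x \<bullet> b) \<partial>N)"
proof -
  interpret M: prob_space M by fact
  interpret N: prob_space N by fact
  define w where "w x = 1 + r x / 2" for x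
  have [measurable]: "w \<in> borel_measurable borel" unfolding w_def by measurable
  have w0: "w x > 0" and w2: "\<bar>w x\<bar> \<le> 2" for x using r1[of x] by (auto simp: w_def)
  have int: "integrable P (\<lambda>x. w x * g x)"
    if "prob_space P" "sets P = sets borel" and [measurable]: "g \<in> borel_measurable borel" and "\<And>x. \<bar>g x\<bar> \<le> 1"
    for P and g :: "'a \<Rightarrow> real"
  proof -
    interpret P: prob_space P by fact
    have [measurable_cong]: "sets P = sets borel" by fact
    show ?thesis
    proof (rule P.integrable_const_bound[of _ 2])
      show "AE x in P. norm (w x * g x) \<le> 2"
        using mult_mono[OF w2 that(4)] by (auto simp: abs_mult)
    qed measurable
  qed
  have ints: "integrable P (\<lambda>x. r x * cos (f x))" "integrable P (\<lambda>x. cos (f x))"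
    if "prob_space P" "sets P = sets borel" and [measurable]: "f \<in> borel_measurable borel"
    for P and f :: "'a \<Rightarrow> real"
  proof -
    interpret P: prob_space P by fact
    have [measurable_cong]: "sets P = sets borel" by fact
    show "integrable P (\<lambda>x. r x * cos (f x))"
    proof (rule P.integrable_const_bound[of _ 1])
      show "AE x in P. norm (r x * cos (f x)) \<le> 1"
        using mult_mono[OF r1 abs_cos_le_one] by (auto simp: abs_mult)
    qed measurable
    show "integrable P (\<lambda>x. cos (f x))"
      by (rule P.integrable_const_bound[of _ 1]) auto
  qed
  have weq: "(\<integral>x. w x * cos (t * (x \<bullet> b) + a) \<partial>M) = (\<integral>x. w x * cos (t * (x \<bullet> b) + a) \<partial>N)" for t a
  proof -
    have "(\<integral>x. w x * cos (t * (x \<bullet> b) + a) \<partial>P) = (\<integral>x. cos (t * (x \<bullet> b) + a) \<partial>P) + (\<integral>x. r x * cos (t * (x \<bullet> b) + a) \<partial>P) / 2"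
      if "prob_space P" "sets P = sets borel" for P
      using ints[OF that, of "\<lambda>x. t * (x \<bullet> b) + a"] unfolding w_def by (simp add: algebra_simps)
    from this[OF M sM] this[OF N sN] show ?thesis using eq1 eq2 by simp
  qed
  \<comment> \<open>The mass of the weight, positive because the weight is at least 1/2. It is the
    same under \<open>M\<close> and \<open>N\<close>, by the cosine identities at frequency and
    phase 0, so the normalised measures can be compared.\<close>
  define m where "m = (\<integral>x. w x \<partial>M)"
  have mN: "m = (\<integral>x. w x \<partial>N)" unfolding m_def using weq[of 0 0] by simp
  have iwM: "integrable M w" using int[OF M sM, of "\<lambda>_. 1"] by simp
  have iwN: "integrable N w" using int[OF N sN, of "\<lambda>_. 1"] by simp
  have m: "m > 0" 
  proof -
    have "1/2 \<le> w x" for x using r1[of x] unfolding w_def by linarith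
    then have "(\<integral>x. 1/2 \<partial>M) \<le> m" unfolding m_def
      using iwM by (intro integral_mono) auto
    then show ?thesis using M.prob_space by simp
  qed
  \<comment> \<open>The law of \<open>x \<bullet> b\<close> under the density \<open>w / m\<close>:
    a probability on the line whose characteristic function is determined by the cosine
    integrals.\<close>
  define D where "D P = distr (density P (\<lambda>x. ennreal (w x / m))) borel (\<lambda>x. x \<bullet> b)" for P :: "'a measure"
  have intD: "(\<integral>y. g y \<partial>D P) = (\<integral>x. (w x / m) *\<^sub>R g (x \<bullet> b) \<partial>P)"
    if "sets P = sets borel" and [measurable]: "g \<in> borel_measurable borel"
    for P and g :: "real \<Rightarrow> 'c::{banach,second_countable_topology}"
  proof -
    have [measurable_cong]: "sets P = sets borel" by fact
    show ?thesis unfolding D_def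
      by (subst integral_distr, measurable) (subst integral_density, auto simp: w0 m less_imp_le)
  qed
  have rdD: "real_distribution (D P)" if P: "prob_space P" "sets P = sets borel" "m = (\<integral>x. w x \<partial>P)" "integrable P w" for P
  proof -
    have [measurable_cong]: "sets P = sets borel" by fact
    have "emeasure (density P (\<lambda>x. ennreal (w x / m))) (space P) = (\<integral>\<^sup>+x. ennreal (w x / m) \<partial>P)"
      by (subst emeasure_density) (auto intro!: nn_integral_cong)
    also have "\<dots> = ennreal (\<integral>x. w x / m \<partial>P)"
      using P(4) by (intro nn_integral_eq_integral) (auto simp: w0 m less_imp_le)
    also have "\<dots> = 1" using P(3) m by simp
    finally have "prob_space (density P (\<lambda>x. ennreal (w x / m)))"
      by (intro prob_spaceI) simp
    then have "prob_space (D P)" unfolding D_def by (rule prob_space.prob_space_distr) simp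
    then show ?thesis by (simp add: real_distribution_def real_distribution_axioms_def D_def)
  qed
  \<comment> \<open>The imaginary part is a sine, that is, a cosine shifted by pi/2; this is why the
    hypotheses carry a free phase \<open>a\<close>.\<close>
  have cexp: "char (D P) t = complex_of_real ((\<integral>x. w x * cos (t * (x \<bullet> b) + 0) \<partial>P) / m)
      + \<i> * complex_of_real ((\<integral>x. w x * cos (t * (x \<bullet> b) + (- pi/2)) \<partial>P) / m)"
    if P: "prob_space P" "sets P = sets borel" for P t
  proof -
    have i1: "integrable P (\<lambda>x. w x * cos (t * (x \<bullet> b)))" and i2: "integrable P (\<lambda>x. w x * sin (t * (x \<bullet> b)))"
      by (rule int[OF P]; simp)+
    have "char (D P) t = (\<integral>x. (w x / m) *\<^sub>R iexp (t * (x \<bullet> b)) \<partial>P)"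
      unfolding char_def by (rule intD[OF P(2)]) simp
    also have "\<dots> = (\<integral>x. complex_of_real (w x * cos (t * (x \<bullet> b)) / m) + \<i> * complex_of_real (w x * sin (t * (x \<bullet> b)) / m) \<partial>P)"
      by (intro Bochner_Integration.integral_cong) (auto simp: complex_eq_iff Re_exp Im_exp)
    also have "\<dots> = complex_of_real (\<integral>x. w x * cos (t * (x \<bullet> b)) / m \<partial>P) + \<i> * complex_of_real (\<integral>x. w x * sin (t * (x \<bullet> b)) / m \<partial>P)"
    proof -
      have "complex_integrable P (\<lambda>x. complex_of_real (w x * cos (t * (x \<bullet> b)) / m))"
           "complex_integrable P (\<lambda>x. complex_of_real (w x * sin (t * (x \<bullet> b)) / m))"
        by (intro integrable_of_real Bochner_Integration.integrable_divide i1 i2)+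
      then show ?thesis
        by (simp only: Bochner_Integration.integral_add integrable_mult_right integral_complex_of_real
            integral_mult_right_zero)
    qed
    finally show ?thesis using i1 i2 by (simp add: cos_diff[of _ "pi/2", simplified])
  qed
  have "char (D M) = char (D N)"
    using weq[of _ 0] weq[of _ "-pi/2"] by (intro ext) (simp add: cexp[OF M sM] cexp[OF N sN])
  then have "D M = D N" by (intro Levy_uniqueness rdD M N sM sN mN iwM iwN) (simp add: m_def)
  moreover have "(\<integral>y. indicator A y \<partial>D P) = (\<integral>x. w x * indicator A (x \<bullet> b) \<partial>P) / m"
    if "sets P = sets borel" for P
    by (subst intD[OF that]) simp_all
  ultimately have "(\<integral>x. w x * indicator A (x \<bullet> b) \<partial>M) / m = (\<integral>x. w x * indicator A (x \<bullet> b) \<partial>N) / m"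
    using sM sN by metis
  then show ?thesis
    using m unfolding w_def by simp
qed

text \<open>Induction on the set of directions. The cosine factor makes the statement feed itself:
  its product with \<open>cos (t * (x \<bullet> b) + c)\<close> is the mean of two cosines of the
  same kind, so the induction hypothesis applies, and \<open>weighted_slab_eq\<close> then trades
  the second cosine for the indicator of a new slab.\<close>

lemma product_slab_cos_eq:
  fixes M N :: "'a::euclidean_space measure"
  assumes M: "prob_space M" and N: "prob_space N" and sM [measurable_cong]: "sets M = sets borel"
    and sN [measurable_cong]: "sets N = sets borel"
    and eq: "\<And>u a. (\<integral>x. cos (x \<bullet> u + a) \<partial>M) = (\<integral>x. cos (x \<bullet> u + a) \<partial>N)"
    and "finite B" and A: "\<And>b. A b \<in> sets borel"
  shows "(\<integral>x. (\<Prod>b\<in>B. indicator (A b) (x \<bullet> b)) * cos (x \<bullet> u + a) \<partial>M)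
       = (\<integral>x. (\<Prod>b\<in>B. indicator (A b) (x \<bullet> b)) * cos (x \<bullet> u + a) \<partial>N)"
  using \<open>finite B\<close>
proof (induction B arbitrary: u a rule: finite_induct)
  case empty
  then show ?case using eq by simp
next
  case (insert b B)
  interpret M: prob_space M by fact
  interpret N: prob_space N by fact
  note A[measurable]
  define r where "r x = (\<Prod>b\<in>B. indicator (A b) (x \<bullet> b)) * cos (x \<bullet> u + a)" for x
  have [measurable]: "r \<in> borel_measurable borel" unfolding r_def by measurable
  have p1: "\<bar>\<Prod>b\<in>B. indicator (A b) (x \<bullet> b)\<bar> \<le> (1::real)" for x
    unfolding abs_prod by (intro prod_le_1) (auto simp: indicator_def)
  have r1: "\<bar>r x\<bar> \<le> 1" for x
    using mult_mono[OF p1 abs_cos_le_one] by (simp add: r_def abs_mult)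
  have int: "integrable P (\<lambda>x. (\<Prod>b\<in>B. indicator (A b) (x \<bullet> b)) * cos (x \<bullet> v + c))"
    if "prob_space P" "sets P = sets borel" for P v c
  proof -
    interpret P: prob_space P by fact
    have [measurable_cong]: "sets P = sets borel" by fact
    show ?thesis
    proof (rule P.integrable_const_bound[of _ 1])
      show "AE x in P. norm ((\<Prod>b\<in>B. indicator (A b) (x \<bullet> b)) * cos (x \<bullet> v + c)) \<le> 1"
        using mult_mono[OF p1 abs_cos_le_one] by (auto simp: abs_mult)
    qed measurable
  qed
  have e2: "(\<integral>x. r x * cos (t * (x \<bullet> b) + c) \<partial>M) = (\<integral>x. r x * cos (t * (x \<bullet> b) + c) \<partial>N)" for t c
  proof -
    have "(\<integral>x. r x * cos (t * (x \<bullet> b) + c) \<partial>P)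
      = ((\<integral>x. (\<Prod>b\<in>B. indicator (A b) (x \<bullet> b)) * cos (x \<bullet> (u - t *\<^sub>R b) + (a - c)) \<partial>P)
       + (\<integral>x. (\<Prod>b\<in>B. indicator (A b) (x \<bullet> b)) * cos (x \<bullet> (u + t *\<^sub>R b) + (a + c)) \<partial>P)) / 2"
      if P: "prob_space P" "sets P = sets borel" for P
    proof -
      have "r x * cos (t * (x \<bullet> b) + c) = ((\<Prod>b\<in>B. indicator (A b) (x \<bullet> b)) * cos (x \<bullet> (u - t *\<^sub>R b) + (a - c))
          + (\<Prod>b\<in>B. indicator (A b) (x \<bullet> b)) * cos (x \<bullet> (u + t *\<^sub>R b) + (a + c))) / 2" for x
      proof -
        have "cos (x \<bullet> u + a) * cos (t * (x \<bullet> b) + c)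
          = (cos (x \<bullet> (u - t *\<^sub>R b) + (a - c)) + cos (x \<bullet> (u + t *\<^sub>R b) + (a + c))) / 2"
          by (subst cos_times_cos) (simp add: inner_diff_right inner_add_right algebra_simps)
        then show ?thesis unfolding r_def mult.assoc by (simp only: add_divide_distrib distrib_left times_divide_eq_right)
      qed
      then show ?thesis using int[OF P]
        by (simp only: integral_divide_zero Bochner_Integration.integral_add)
    qed
    from this[OF M sM] this[OF N sN] show ?thesis using insert.IH by simp
  qed
  have e1: "(\<integral>x. cos (t * (x \<bullet> b) + c) \<partial>M) = (\<integral>x. cos (t * (x \<bullet> b) + c) \<partial>N)" for t c
    using eq[of "t *\<^sub>R b" c] by simp
  \<comment> \<open>Weight zero: the same lemma also compares the plain slabs, which are subtracted
    below to isolate \<open>r\<close>.\<close>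
  have e0: "(\<integral>x. 0 * cos (t * (x \<bullet> b) + c) \<partial>M) = (\<integral>x. 0 * cos (t * (x \<bullet> b) + c) \<partial>N)" for t c
    by simp
  have w: "(\<integral>x. (1 + r x / 2) * indicator (A b) (x \<bullet> b) \<partial>M) = (\<integral>x. (1 + r x / 2) * indicator (A b) (x \<bullet> b) \<partial>N)"
    by (rule weighted_slab_eq[OF M N sM sN _ r1 e1 e2 A]) measurable
  have i: "(\<integral>x. indicator (A b) (x \<bullet> b) \<partial>M) = (\<integral>x. (indicator (A b) (x \<bullet> b) :: real) \<partial>N)"
    using weighted_slab_eq[OF M N sM sN _ _ e1 e0 A[of b]] by simp
  \<comment> \<open>Undoes the positive weight, as \<open>r = 2 * ((1 + r / 2) - 1)\<close>.\<close>
  have "(\<integral>x. (\<Prod>b\<in>insert b B. indicator (A b) (x \<bullet> b)) * cos (x \<bullet> u + a) \<partial>P)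
      = 2 * ((\<integral>x. (1 + r x / 2) * indicator (A b) (x \<bullet> b) \<partial>P) - (\<integral>x. indicator (A b) (x \<bullet> b) \<partial>P))"
    if P: "prob_space P" "sets P = sets borel" for P
  proof -
    interpret P: prob_space P by fact
    have [measurable_cong]: "sets P = sets borel" by fact
    have i1: "integrable P (\<lambda>x. indicator (A b) (x \<bullet> b) :: real)"
      by (rule P.integrable_const_bound[of _ 1]) auto
    have i2: "integrable P (\<lambda>x. r x * indicator (A b) (x \<bullet> b))"
      by (rule P.integrable_const_bound[of _ 1]) (use r1 in \<open>auto simp: abs_mult indicator_def\<close>)
    have "(\<integral>x. (1 + r x / 2) * indicator (A b) (x \<bullet> b) \<partial>P)
       = (\<integral>x. indicator (A b) (x \<bullet> b) \<partial>P) + (\<integral>x. r x * indicator (A b) (x \<bullet> b) \<partial>P) / 2"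
      using i1 i2 by (simp add: algebra_simps)
    moreover have "(\<integral>x. (\<Prod>b\<in>insert b B. indicator (A b) (x \<bullet> b)) * cos (x \<bullet> u + a) \<partial>P)
       = (\<integral>x. r x * indicator (A b) (x \<bullet> b) \<partial>P)"
      using insert.hyps by (intro Bochner_Integration.integral_cong) (auto simp: r_def)
    ultimately show ?thesis by simp
  qed
  from this[OF M sM] this[OF N sN] show ?case using w i by simp
qed

text \<open>Boxes form an intersection-stable generator, and the indicator of a box is a product of
  slabs along the basis vectors; frequency 0 and phase 0 turn the cosine of
  \<open>product_slab_cos_eq\<close> into 1.\<close>

theorem euclidean_measure_eqI_cos:
  fixes M N :: "'a::euclidean_space measure"
  assumes M: "prob_space M" and N: "prob_space N" and sM [measurable_cong]: "sets M = sets borel"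
    and sN [measurable_cong]: "sets N = sets borel"
    and eq: "\<And>u a. (\<integral>x. cos (x \<bullet> u + a) \<partial>M) = (\<integral>x. cos (x \<bullet> u + a) \<partial>N)"
  shows "M = N"
proof (rule measure_eqI_generator_eq)
  interpret M: prob_space M by fact
  interpret N: prob_space N by fact
  let ?E = "range (\<lambda>(a, b). box a b :: 'a set)"
  show "Int_stable ?E"
    by (auto simp: Int_stable_def box_Int_box)
  show "?E \<subseteq> Pow UNIV" "sets M = sigma_sets UNIV ?E" "sets N = sigma_sets UNIV ?E"
    by (simp_all add: borel_eq_box sM sN)
  let ?A = "\<lambda>n::nat. box (- (real n *\<^sub>R One)) (real n *\<^sub>R One) :: 'a set"
  show "range ?A \<subseteq> ?E" "(\<Union>i. ?A i) = UNIV"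
    unfolding UN_box_eq_UNIV by auto
  show "emeasure M (?A i) \<noteq> \<infinity>" for i by simp
  fix X assume "X \<in> ?E"
  then obtain l u where X: "X = box l u" by auto
  have ind: "indicator X x = (\<Prod>b\<in>Basis. indicator {l \<bullet> b<..<u \<bullet> b} (x \<bullet> b)) * cos (x \<bullet> 0 + 0)" for x
    unfolding X by (auto simp: indicator_def mem_box prod_zero_iff)
  have [simp]: "X \<in> sets M" "X \<in> sets N" by (simp_all add: X sM sN)
  have "measure M X = (\<integral>x. indicator X x \<partial>M)" by simp
  also have "\<dots> = (\<integral>x. indicator X x \<partial>N)"
    unfolding ind by (rule product_slab_cos_eq[OF M N sM sN eq]) auto
  also have "\<dots> = measure N X" by simp
  finally show "emeasure M X = emeasure N X"
    by (simp add: M.emeasure_eq_measure N.emeasure_eq_measure)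
qed

subsection \<open>Gaussian integration by parts\<close>

lemma borel_measurable_differentiable:
  fixes f :: "real^'d::finite \<Rightarrow> real"
  assumes "\<And>x. f differentiable (at x)"
  shows "f \<in> borel_measurable borel"
  using assms by (intro borel_measurable_continuous_onI)
    (simp add: continuous_on_eq_continuous_within differentiable_imp_continuous_within differentiable_at_withinI)

lemma borel_measurable_vec_nth [measurable]:
  "(\<lambda>v :: real^'d::finite. v $ i) \<in> borel_measurable borel"
  by (intro borel_measurable_continuous_onI continuous_intros)

lemma lipschitz_partial_bound:
  fixes f :: "real^'d::finite \<Rightarrow> real"
  assumes f: "\<And>x. f differentiable (at x)" and K: "\<And>j x. \<bar>partial j f x\<bar> \<le> K"
  shows "\<bar>f (y + v) - f y\<bar> \<le> real CARD('d) * K * norm v"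
proof -
  have "((\<lambda>t. f (y + t *\<^sub>R v)) has_real_derivative (\<Sum>j\<in>UNIV. v $ j * partial j f (y + t *\<^sub>R v))) (at t)" for t
    by (intro DERIV_line f)
  then obtain t where t: "f (y + 1 *\<^sub>R v) - f (y + 0 *\<^sub>R v) = (1 - 0) * (\<Sum>j\<in>UNIV. v $ j * partial j f (y + t *\<^sub>R v))"
    using MVT2[of 0 1 "\<lambda>t. f (y + t *\<^sub>R v)" "\<lambda>t. \<Sum>j\<in>UNIV. v $ j * partial j f (y + t *\<^sub>R v)"] by auto
  have "\<bar>\<Sum>j\<in>UNIV. v $ j * partial j f (y + t *\<^sub>R v)\<bar> \<le> (\<Sum>j\<in>(UNIV::'d set). norm v * K)"
    by (intro order_trans[OF sum_abs] sum_mono)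
       (auto simp: abs_mult intro!: mult_mono K component_le_norm_cart)
  also have "\<dots> = real CARD('d) * K * norm v" by simp
  finally show ?thesis using t by simp
qed

text \<open>Second moments are all that is assumed about the size of \<open>W\<close>. The
  integrands built from \<open>h\<close> and its gradient grow at most quadratically, so this
  criterion covers them; with both vectors equal to \<open>Z\<close> it also serves for two
  independent copies.\<close>

lemma integrable_pair_quadratic:
  fixes F :: "'a \<times> 'b \<Rightarrow> real" and U :: "'a \<Rightarrow> real^'d::finite" and V :: "'b \<Rightarrow> real^'e::finite"
  assumes M: "prob_space M" and N: "prob_space N"
    and U: "integrable M (\<lambda>x. (norm (U x))\<^sup>2)" and V: "integrable N (\<lambda>x. (norm (V x))\<^sup>2)"
    and F: "F \<in> borel_measurable (M \<Otimes>\<^sub>M N)"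
    and b: "\<And>x y. \<bar>F (x, y)\<bar> \<le> C * (1 + (norm (U x))\<^sup>2 + (norm (V y))\<^sup>2)"
  shows "integrable (M \<Otimes>\<^sub>M N) F"
proof -
  interpret M: prob_space M by fact
  interpret N: prob_space N by fact
  interpret pair_prob_space M N ..
  have "integrable (distr (M \<Otimes>\<^sub>M N) M fst) (\<lambda>x. (norm (U x))\<^sup>2)"
    using U by (simp add: N.distr_pair_fst)
  then have 1: "integrable (M \<Otimes>\<^sub>M N) (\<lambda>z. (norm (U (fst z)))\<^sup>2)"
    by (rule integrable_distr[rotated]) simp
  have "integrable (N \<Otimes>\<^sub>M M) (\<lambda>(x, y). (norm (V x))\<^sup>2)"
  proof -
    have "integrable (distr (N \<Otimes>\<^sub>M M) N fst) (\<lambda>x. (norm (V x))\<^sup>2)"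
      using V by (simp add: M.distr_pair_fst)
    then have "integrable (N \<Otimes>\<^sub>M M) (\<lambda>z. (norm (V (fst z)))\<^sup>2)"
      by (rule integrable_distr[rotated]) simp
    then show ?thesis by (simp add: case_prod_beta')
  qed
  then have 2: "integrable (M \<Otimes>\<^sub>M N) (\<lambda>z. (norm (V (snd z)))\<^sup>2)"
    using integrable_product_swap_iff[of "\<lambda>z. (norm (V (snd z)))\<^sup>2"] by simp
  have "integrable (M \<Otimes>\<^sub>M N) (\<lambda>z. C * (1 + (norm (U (fst z)))\<^sup>2 + (norm (V (snd z)))\<^sup>2))"
    using 1 2 by auto
  then show ?thesis
  proof (rule Bochner_Integration.integrable_bound)
    show "AE z in M \<Otimes>\<^sub>M N. norm (F z) \<le> norm (C * (1 + (norm (U (fst z)))\<^sup>2 + (norm (V (snd z)))\<^sup>2))"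
    proof (rule AE_I2)
      fix z
      show "norm (F z) \<le> norm (C * (1 + (norm (U (fst z)))\<^sup>2 + (norm (V (snd z)))\<^sup>2))"
        using order_trans[OF b[of "fst z" "snd z"] abs_ge_self] by simp
    qed
  qed (rule F)
qed

lemma le_one_plus_square: "(a::real) \<le> 1 + a\<^sup>2"
  using zero_le_power2[of "a - 1/2"] by (simp add: power2_eq_square algebra_simps)

lemma integrable_norm_of_square:
  fixes U :: "'a \<Rightarrow> 'b::euclidean_space"
  assumes "prob_space M" "U \<in> borel_measurable M" "integrable M (\<lambda>x. (norm (U x))\<^sup>2)"
  shows "integrable M (\<lambda>x. norm (U x))"
proof -
  interpret prob_space M by fact

  have "integrable M (\<lambda>x. 1 + (norm (U x))\<^sup>2)" using assms by auto
  then show ?thesis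
    by (rule Bochner_Integration.integrable_bound) (use assms(2) le_one_plus_square in auto)
qed

lemma integrable_norm_sq:
  fixes U :: "'a \<Rightarrow> real^'d::finite"
  assumes "\<And>i. integrable M (\<lambda>x. (U x $ i)\<^sup>2)"
  shows "integrable M (\<lambda>x. (norm (U x))\<^sup>2)"
proof -
  have "(norm (U x))\<^sup>2 = (\<Sum>i\<in>UNIV. (U x $ i)\<^sup>2)" for x
    unfolding norm_vec_def L2_set_def by (simp add: sum_nonneg)
  then show ?thesis using assms by simp
qed

text \<open>Symmetry and semidefiniteness are separate assumptions because
  \<open>centred_gaussian\<close> sees only the quadratic form of \<open>S\<close>;
  \<open>gaussian_vector_cov\<close> supplies them for a covariance matrix. \<open>S\<close> may be
  singular.\<close>

locale gaussian_vector = prob_space N for N :: "'b measure" +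
  fixes Z :: "'b \<Rightarrow> real^'d::finite" and S :: "real^'d^'d"
  assumes gauss: "centred_gaussian N Z S"
    and S_sym: "S $ i $ j = S $ j $ i"
    and S_psd: "u \<bullet> (S *v u) \<ge> 0"
begin

lemma Z_measurable [measurable]: "Z \<in> borel_measurable N"
  using gauss by (simp add: centred_gaussian_def)

lemma inner_S_sym: "u \<bullet> (S *v v) = v \<bullet> (S *v u)"
proof -
  have "transpose S = S" by (simp add: transpose_def vec_eq_iff S_sym)
  then show ?thesis by (metis dot_lmul_matrix vector_transpose_matrix inner_commute)
qed

lemma projection_standard:
  assumes "u \<bullet> (S *v u) > 0"
  shows "distr N borel (\<lambda>w. (u \<bullet> Z w) / sqrt (u \<bullet> (S *v u))) = std_normal_distribution"
proof -
  let ?s = "sqrt (u \<bullet> (S *v u))"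
  have s: "?s > 0" using assms by simp
  have "distr N borel (\<lambda>w. u \<bullet> Z w) = density lborel (normal_density 0 ?s)"
    using gauss assms unfolding centred_gaussian_def Let_def by auto
  moreover have "distr N lborel (\<lambda>w. u \<bullet> Z w) = distr N borel (\<lambda>w. u \<bullet> Z w)"
    by (rule distr_cong) auto
  ultimately have "distributed N lborel (\<lambda>w. u \<bullet> Z w) (normal_density 0 ?s)"
    unfolding distributed_def by simp
  then have "distributed N lborel (\<lambda>w. (u \<bullet> Z w - 0) / ?s) std_normal_density"
    using normal_standard_normal_convert[OF s, of "\<lambda>w. u \<bullet> Z w" 0] by simp
  then have "distr N lborel (\<lambda>w. (u \<bullet> Z w) / ?s) = std_normal_distribution"
    unfolding distributed_def by simp
  moreover have "distr N lborel (\<lambda>w. (u \<bullet> Z w) / ?s) = distr N borel (\<lambda>w. (u \<bullet> Z w) / ?s)"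
    by (rule distr_cong) auto
  ultimately show ?thesis by simp
qed

lemma projection_degenerate:
  assumes "u \<bullet> (S *v u) = 0"
  shows "AE w in N. u \<bullet> Z w = 0"
proof -
  have d: "distr N borel (\<lambda>w. u \<bullet> Z w) = return borel 0"
    using gauss assms unfolding centred_gaussian_def Let_def by auto
  have "AE y in distr N borel (\<lambda>w. u \<bullet> Z w). y = 0"
    unfolding d by (subst AE_return) auto
  then show ?thesis by (subst (asm) AE_distr_iff) auto
qed

text \<open>One formula for regular and singular directions: at variance 0 both sides are
  \<open>g 0\<close>, since the projection vanishes almost surely and the standard normal variable
  is multiplied by 0.\<close>

lemma integral_projection:
  fixes g :: "real \<Rightarrow> real"
  assumes [measurable]: "g \<in> borel_measurable borel"
  shows "(\<integral>w. g (u \<bullet> Z w) \<partial>N) = (\<integral>x. g (sqrt (u \<bullet> (S *v u)) * x) \<partial>std_normal_distribution)"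
proof (cases "u \<bullet> (S *v u) = 0")
  case True
  interpret std: real_distribution std_normal_distribution by (rule real_dist_normal_dist)
  have "(\<integral>w. g (u \<bullet> Z w) \<partial>N) = (\<integral>w. g 0 \<partial>N)"
    using projection_degenerate[OF True] by (intro integral_cong_AE) auto
  also have "\<dots> = g 0" by (simp add: prob_space)
  also have "\<dots> = (\<integral>x. g (sqrt (u \<bullet> (S *v u)) * x) \<partial>std_normal_distribution)"
    using True std.prob_space by simp
  finally show ?thesis .
next
  case False
  then have q: "u \<bullet> (S *v u) > 0" using S_psd[of u] by simp
  show ?thesis
    using q by (subst projection_standard[OF q, symmetric], subst integral_distr) auto
qed

lemma integrable_projection_square: "integrable N (\<lambda>w. (u \<bullet> Z w)\<^sup>2)"
proof (cases "u \<bullet> (S *v u) = 0")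
  case True
  have "AE w in N. (u \<bullet> Z w)\<^sup>2 = 0" using projection_degenerate[OF True] by auto
  then show ?thesis by (subst integrable_cong_AE[where g = "\<lambda>_. 0"]) auto
next
  case False
  then have q: "u \<bullet> (S *v u) > 0" using S_psd[of u] by simp
  have "integrable (distr N borel (\<lambda>w. (u \<bullet> Z w) / sqrt (u \<bullet> (S *v u)))) (\<lambda>x. x ^ 2)"
    unfolding projection_standard[OF q] by (rule integrable_std_normal_distribution_moment)
  then have "integrable N (\<lambda>w. ((u \<bullet> Z w) / sqrt (u \<bullet> (S *v u)))\<^sup>2)"
    by (subst (asm) integrable_distr_eq) auto
  then have "integrable N (\<lambda>w. (u \<bullet> (S *v u)) * ((u \<bullet> Z w) / sqrt (u \<bullet> (S *v u)))\<^sup>2)"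
    by simp
  then show ?thesis using q by (simp add: power_divide)
qed

lemma expectation_projection: "(\<integral>w. u \<bullet> Z w \<partial>N) = 0"
  using integral_projection[of "\<lambda>x. x" u] integral_std_normal_distribution_moment_odd[of 1] by simp

lemma expectation_projection_square: "(\<integral>w. (u \<bullet> Z w)\<^sup>2 \<partial>N) = u \<bullet> (S *v u)"
  using integral_projection[of "\<lambda>x. x\<^sup>2" u] std_normal_distribution_even_moments[of 1] S_psd[of u]
  by (simp add: power_mult_distrib)

text \<open>The characteristic function in real form. The phase covers the sine part and lets two
  independent copies be integrated out one after the other.\<close>

lemma expectation_cos_projection:
  "(\<integral>w. cos (u \<bullet> Z w + a) \<partial>N) = cos a * exp (- (u \<bullet> (S *v u)) / 2)"
proof -
  interpret std: real_distribution std_normal_distribution by (rule real_dist_normal_dist)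
  let ?s = "sqrt (u \<bullet> (S *v u))"
  have i1: "integrable std_normal_distribution (\<lambda>x. cos (?s * x))"
    by (rule std.integrable_const_bound[of _ 1]) auto
  have i2: "integrable std_normal_distribution (\<lambda>x. sin (?s * x))"
    by (rule std.integrable_const_bound[of _ 1]) auto
  have ci: "complex_integrable std_normal_distribution (\<lambda>x. iexp (?s * x))"
    by (rule std.integrable_const_bound[of _ 1]) auto
  have ch: "(CLINT x|std_normal_distribution. iexp (?s * x)) = complex_of_real (exp (- (u \<bullet> (S *v u)) / 2))"
    using char_std_normal_distribution S_psd[of u] unfolding char_def fun_eq_iff by simp
  have c: "(\<integral>x. cos (?s * x) \<partial>std_normal_distribution) = exp (- (u \<bullet> (S *v u)) / 2)"
    using integral_Re[OF ci] unfolding ch by (simp add: Re_exp)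
  have s: "(\<integral>x. sin (?s * x) \<partial>std_normal_distribution) = 0"
    using integral_Im[OF ci] unfolding ch by (simp add: Im_exp)
  have "(\<integral>w. cos (u \<bullet> Z w + a) \<partial>N) = (\<integral>x. cos (?s * x) * cos a - sin (?s * x) * sin a \<partial>std_normal_distribution)"
    using integral_projection[of "\<lambda>x. cos (x + a)" u] by (simp add: cos_add)
  also have "\<dots> = cos a * exp (- (u \<bullet> (S *v u)) / 2)"
    using i1 i2 c s by simp
  finally show ?thesis .
qed

lemma integrable_component_square: "integrable N (\<lambda>w. (Z w $ i)\<^sup>2)"
  using integrable_projection_square[of "axis i 1"] by (simp add: inner_axis' )

lemma integrable_norm_square: "integrable N (\<lambda>w. (norm (Z w))\<^sup>2)"
  by (intro integrable_norm_sq integrable_component_square)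

lemma expectation_component: "(\<integral>w. Z w $ i \<partial>N) = 0"
  using expectation_projection[of "axis i 1"] by (simp add: inner_axis')

text \<open>Polarisation, as only the variances of projections are known.\<close>

lemma expectation_component_product: "(\<integral>w. Z w $ i * Z w $ j \<partial>N) = S $ i $ j"
proof -
  let ?p = "axis i 1 + axis j 1 :: real^'d" and ?m = "axis i 1 - axis j 1 :: real^'d"
  have eq: "Z w $ i * Z w $ j = ((?p \<bullet> Z w)\<^sup>2 - (?m \<bullet> Z w)\<^sup>2) / 4" for w
    by (simp add: inner_axis' inner_add_left inner_diff_left power2_eq_square algebra_simps)
  have "(\<integral>w. Z w $ i * Z w $ j \<partial>N) = (?p \<bullet> (S *v ?p) - ?m \<bullet> (S *v ?m)) / 4"
    unfolding eq using integrable_projection_square by (simp add: expectation_projection_square)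
  also have "\<dots> = axis i 1 \<bullet> (S *v axis j 1)"
    using inner_S_sym[of "axis i 1" "axis j 1"]
    by (simp add: matrix_vector_right_distrib matrix_vector_mult_diff_distrib inner_simps)
  also have "\<dots> = S $ i $ j"
    by (simp add: inner_axis' matrix_vector_mul_component inner_axis)
  finally show ?thesis .
qed

text \<open>For an independent copy \<open>Z'\<close>, the pairs \<open>(Z + t Z', \<plusminus> (Z' - t Z))\<close> have the same law,
  since their projections have equal variances.\<close>

lemma rotation_reflection_law:
  "distr (N \<Otimes>\<^sub>M N) borel (\<lambda>(x, y). (Z x + t *\<^sub>R Z y, Z y - t *\<^sub>R Z x))
   = distr (N \<Otimes>\<^sub>M N) borel (\<lambda>(x, y). (Z x + t *\<^sub>R Z y, - (Z y - t *\<^sub>R Z x)))" (is "distr ?P borel ?U = distr ?P borel ?V")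
proof -
  interpret P: pair_prob_space N N ..
  let ?Q = "\<lambda>u. u \<bullet> (S *v u)"
  have [measurable]: "?U \<in> ?P \<rightarrow>\<^sub>M borel" "?V \<in> ?P \<rightarrow>\<^sub>M borel"
    unfolding borel_prod[symmetric] by measurable
  \<comment> \<open>Integrating out the second copy while the first is absorbed into the phase shows
    that the value depends on \<open>p\<close> and \<open>q\<close> only through
    \<open>?Q p + ?Q q\<close>.\<close>
  have joint: "(\<integral>z. cos (p \<bullet> Z (fst z) + q \<bullet> Z (snd z) + a) \<partial>?P) = cos a * exp (- (?Q p + ?Q q) / 2)" for p q a
  proof -
    have "(\<integral>z. cos (p \<bullet> Z (fst z) + q \<bullet> Z (snd z) + a) \<partial>?P) = (\<integral>x. (\<integral>y. cos (p \<bullet> Z x + q \<bullet> Z y + a) \<partial>N) \<partial>N)"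
      by (subst P.integral_fst'[symmetric]) (auto intro!: P.P.integrable_const_bound[of _ 1])
    also have "\<dots> = (\<integral>x. cos (p \<bullet> Z x + a) * exp (- ?Q q / 2) \<partial>N)"
      using expectation_cos_projection[of q "p \<bullet> Z x + a" for x] by (simp add: algebra_simps)
    also have "\<dots> = cos a * exp (- (?Q p + ?Q q) / 2)"
      by (simp add: expectation_cos_projection exp_add[symmetric] add_divide_distrib diff_divide_distrib)
    finally show ?thesis .
  qed
  \<comment> \<open>The cross terms cancel by symmetry of \<open>S\<close>, here and with opposite
    signs in \<open>q'\<close>, so both pairs get the same value.\<close>
  have q: "?Q (u - t *\<^sub>R v) + ?Q (t *\<^sub>R u + v) = (1 + t\<^sup>2) * (?Q u + ?Q v)" for u v
    using inner_S_sym[of u v]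
    by (simp add: matrix_vector_right_distrib matrix_vector_mult_diff_distrib matrix_vector_mult_scaleR
        inner_simps power2_eq_square algebra_simps)
  have q': "?Q (u + t *\<^sub>R v) + ?Q (t *\<^sub>R u - v) = (1 + t\<^sup>2) * (?Q u + ?Q v)" for u v
    using inner_S_sym[of u v]
    by (simp add: matrix_vector_right_distrib matrix_vector_mult_diff_distrib matrix_vector_mult_scaleR
        inner_simps power2_eq_square algebra_simps)
  show ?thesis
  proof (rule euclidean_measure_eqI_cos)
    fix u :: "(real^'d) \<times> (real^'d)" and a
    obtain u1 u2 where u: "u = (u1, u2)" by (cases u)
    have "(\<integral>x. cos (x \<bullet> u + a) \<partial>distr ?P borel ?U)
        = (\<integral>z. cos ((u1 - t *\<^sub>R u2) \<bullet> Z (fst z) + (t *\<^sub>R u1 + u2) \<bullet> Z (snd z) + a) \<partial>?P)"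
      by (subst integral_distr, measurable) (auto simp: u case_prod_beta inner_simps inner_commute algebra_simps intro!: Bochner_Integration.integral_cong)
    also have "\<dots> = (\<integral>z. cos ((u1 + t *\<^sub>R u2) \<bullet> Z (fst z) + (t *\<^sub>R u1 - u2) \<bullet> Z (snd z) + a) \<partial>?P)"
      unfolding joint q q' ..
    also have "\<dots> = (\<integral>x. cos (x \<bullet> u + a) \<partial>distr ?P borel ?V)"
      by (subst integral_distr, measurable) (auto simp: u case_prod_beta inner_simps inner_commute algebra_simps intro!: Bochner_Integration.integral_cong)
    finally show "(\<integral>x. cos (x \<bullet> u + a) \<partial>distr ?P borel ?U) = (\<integral>x. cos (x \<bullet> u + a) \<partial>distr ?P borel ?V)" .
  qed (auto intro!: P.P.prob_space_distr)
qed

text \<open>The integrand is odd in the second component, whose sign may be flipped without changing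
  the joint law, so the integral equals its own negative. Integrability plays no part in this,
  because a Bochner integral that does not exist is 0.\<close>

lemma rotation_orthogonality:
  fixes f :: "real^'d \<Rightarrow> real"
  assumes [measurable]: "f \<in> borel_measurable borel"
  shows "(\<integral>(x, y). f (Z x + t *\<^sub>R Z y) * (Z y - t *\<^sub>R Z x) $ i \<partial>(N \<Otimes>\<^sub>M N)) = 0"
proof -
  let ?P = "N \<Otimes>\<^sub>M N"
  let ?U = "\<lambda>(x, y). (Z x + t *\<^sub>R Z y, Z y - t *\<^sub>R Z x)"
  let ?V = "\<lambda>(x, y). (Z x + t *\<^sub>R Z y, - (Z y - t *\<^sub>R Z x))"
  let ?F = "\<lambda>z :: (real^'d) \<times> (real^'d). f (fst z) * snd z $ i"
  have [measurable]: "?U \<in> ?P \<rightarrow>\<^sub>M borel" "?V \<in> ?P \<rightarrow>\<^sub>M borel" "?F \<in> borel_measurable borel"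
    unfolding borel_prod[symmetric] by measurable
  have "(\<integral>z. ?F (?U z) \<partial>?P) = (\<integral>z. ?F z \<partial>distr ?P borel ?U)"
    by (rule integral_distr[symmetric]) measurable
  also have "\<dots> = (\<integral>z. ?F (?V z) \<partial>?P)"
    unfolding rotation_reflection_law by (rule integral_distr) measurable
  also have "\<dots> = (\<integral>z. - ?F (?U z) \<partial>?P)"
    by (intro Bochner_Integration.integral_cong) (auto simp: case_prod_beta algebra_simps)
  also have "\<dots> = - (\<integral>z. ?F (?U z) \<partial>?P)"
    by (rule integral_minus)
  finally show ?thesis by (simp add: case_prod_beta')
qed

text \<open>With an independent copy \<open>Z'\<close>, orthogonality reads
  \<open>E f(Z + t Z') Z'_i = t E f(Z + t Z') Z_i\<close>. As \<open>E f(Z) Z'_i = 0\<close>, the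
  left side may be written with the increment of \<open>f\<close>. Dividing by \<open>t\<close> and
  letting \<open>t\<close> tend to 0 leaves the derivative of \<open>f\<close> at \<open>Z\<close>
  in direction \<open>Z'\<close>, times \<open>Z'_i\<close>; independence and
  \<open>E Z'_i Z'_j = S_ij\<close> give the sum.\<close>

theorem integration_by_parts:
  fixes f :: "real^'d \<Rightarrow> real"
  assumes f: "\<And>x. f differentiable (at x)" and K: "\<And>j x. \<bar>partial j f x\<bar> \<le> K"
    and [measurable]: "\<And>j. partial j f \<in> borel_measurable borel"
  shows "(\<integral>x. Z x $ i * f (Z x) \<partial>N) = (\<Sum>j\<in>UNIV. S $ i $ j * (\<integral>x. partial j f (Z x) \<partial>N))"
proof -
  interpret P: pair_prob_space N N ..
  let ?P = "N \<Otimes>\<^sub>M N"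
  define L where "L = real CARD('d) * K"
  have "0 \<le> K" using K[of undefined undefined] by linarith
  then have L0: "L \<ge> 0" by (simp add: L_def)
  have lip: "\<bar>f (y + v) - f y\<bar> \<le> L * norm v" for y v
    unfolding L_def using lipschitz_partial_bound[OF f K] .
  have [measurable]: "f \<in> borel_measurable borel"
    using f by (rule borel_measurable_differentiable)
  have growth: "\<bar>f y\<bar> \<le> \<bar>f 0\<bar> + L * norm y" for y using lip[of 0 y] by simp
  have comp: "\<bar>v $ j\<bar> \<le> norm v" for v :: "real^'d" and j by (rule component_le_norm_cart)

  \<comment> \<open>Let \<open>a\<close>, \<open>b\<close> be the norms of the two copies and
    \<open>c\<close> one of them. Then \<open>c \<le> 1 + a^2 + b^2\<close> goes with the constant
    part of the growth bound, and \<open>(a + b) * c \<le> 2 * (1 + a^2 + b^2)\<close> with the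
    linear part, whence the 2.\<close>
  define C where "C = \<bar>f 0\<bar> + 2 * L"
  have C0: "C \<ge> 0" using L0 by (simp add: C_def)
  have bound1: "\<bar>f (Z x + t *\<^sub>R Z y) * Z x $ i\<bar> \<le> C * (1 + (norm (Z x))\<^sup>2 + (norm (Z y))\<^sup>2)"
    and bound2: "\<bar>f (Z x + t *\<^sub>R Z y) * Z y $ i\<bar> \<le> C * (1 + (norm (Z x))\<^sup>2 + (norm (Z y))\<^sup>2)"
    if t: "\<bar>t\<bar> \<le> 1" for t x y
  proof -
    define a where "a = norm (Z x)"
    define b where "b = norm (Z y)"
    have ab: "a \<ge> 0" "b \<ge> 0" by (auto simp: a_def b_def)
    have "norm (Z x + t *\<^sub>R Z y) \<le> a + \<bar>t\<bar> * b"
      using norm_triangle_ineq[of "Z x" "t *\<^sub>R Z y"] by (simp add: a_def b_def)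
    also have "\<dots> \<le> a + b" using mult_right_mono[OF t ab(2)] by simp
    finally have fb: "\<bar>f (Z x + t *\<^sub>R Z y)\<bar> \<le> \<bar>f 0\<bar> + L * (a + b)"
      using growth[of "Z x + t *\<^sub>R Z y"] mult_left_mono[OF _ L0] by (meson add_left_mono order_trans)
    have gen: "(\<bar>f 0\<bar> + L * (a + b)) * c \<le> C * (1 + a\<^sup>2 + b\<^sup>2)" if c: "c = a \<or> c = b" for c
    proof -
      have c0: "c \<ge> 0" using c ab by auto
      have "c \<le> 1 + a\<^sup>2 + b\<^sup>2"
        using c le_one_plus_square[of a] le_one_plus_square[of b] zero_le_power2[of a] zero_le_power2[of b]
        by linarith
      moreover have "(a + b) * c \<le> 2 * (1 + a\<^sup>2 + b\<^sup>2)"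
      proof -
        have "(a + b) * c \<le> (a + b)\<^sup>2" using c ab c0 unfolding power2_eq_square by (intro mult_left_mono) auto
        also have "\<dots> \<le> 2 * (1 + a\<^sup>2 + b\<^sup>2)"
            using zero_le_power2[of "a - b"] by (simp add: power2_eq_square algebra_simps)
        finally show ?thesis .
      qed
      ultimately have "\<bar>f 0\<bar> * c + L * ((a + b) * c) \<le> \<bar>f 0\<bar> * (1 + a\<^sup>2 + b\<^sup>2) + L * (2 * (1 + a\<^sup>2 + b\<^sup>2))"
        using L0 by (intro add_mono mult_left_mono) auto
      then show ?thesis by (simp add: C_def algebra_simps)
    qed
    have pos: "0 \<le> \<bar>f 0\<bar> + L * (a + b)" using L0 ab by simp
    have "\<bar>f (Z x + t *\<^sub>R Z y) * Z x $ i\<bar> \<le> (\<bar>f 0\<bar> + L * (a + b)) * a"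
      unfolding abs_mult a_def[symmetric] using comp[of "Z x" i] pos by (intro mult_mono fb) (auto simp: a_def)
    from order_trans[OF this gen[of a]]
    show "\<bar>f (Z x + t *\<^sub>R Z y) * Z x $ i\<bar> \<le> C * (1 + (norm (Z x))\<^sup>2 + (norm (Z y))\<^sup>2)"
      by (simp add: a_def b_def)
    have "\<bar>f (Z x + t *\<^sub>R Z y) * Z y $ i\<bar> \<le> (\<bar>f 0\<bar> + L * (a + b)) * b"
      unfolding abs_mult b_def[symmetric] using comp[of "Z y" i] pos by (intro mult_mono fb) (auto simp: b_def)
    from order_trans[OF this gen[of b]]
    show "\<bar>f (Z x + t *\<^sub>R Z y) * Z y $ i\<bar> \<le> C * (1 + (norm (Z x))\<^sup>2 + (norm (Z y))\<^sup>2)"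
      by (simp add: a_def b_def)
  qed
  note quad = integrable_pair_quadratic[OF prob_space_axioms prob_space_axioms integrable_norm_square integrable_norm_square]
  have i1: "integrable ?P (\<lambda>z. f (Z (fst z) + t *\<^sub>R Z (snd z)) * Z (fst z) $ i)" if "\<bar>t\<bar> \<le> 1" for t
  proof (rule quad)
    show "\<bar>f (Z (fst (x, y)) + t *\<^sub>R Z (snd (x, y))) * Z (fst (x, y)) $ i\<bar>
        \<le> C * (1 + (norm (Z x))\<^sup>2 + (norm (Z y))\<^sup>2)" for x y
      using bound1[OF that] by simp
  qed measurable
  have i2: "integrable ?P (\<lambda>z. f (Z (fst z) + t *\<^sub>R Z (snd z)) * Z (snd z) $ i)" if "\<bar>t\<bar> \<le> 1" for t
  proof (rule quad)
    show "\<bar>f (Z (fst (x, y)) + t *\<^sub>R Z (snd (x, y))) * Z (snd (x, y)) $ i\<bar>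
        \<le> C * (1 + (norm (Z x))\<^sup>2 + (norm (Z y))\<^sup>2)" for x y
      using bound2[OF that] by simp
  qed measurable
  have z0: "(\<integral>z. f (Z (fst z)) * Z (snd z) $ i \<partial>?P) = 0"
  proof -
    have "(\<integral>z. f (Z (fst z)) * Z (snd z) $ i \<partial>?P) = (\<integral>x. (\<integral>y. f (Z x) * Z y $ i \<partial>N) \<partial>N)"
      using P.integral_fst'[OF i2[of 0]] by simp
    then show ?thesis by (simp add: expectation_component)
  qed
  \<comment> \<open>Nonzero, so that one may divide by it, and at most 1, so that the bounds above
    apply.\<close>
  define X where "X n = inverse (real (Suc n))" for n
  have X: "X n > 0" "\<bar>X n\<bar> \<le> 1" for n unfolding X_def by (auto simp: field_simps)
  have X0: "X \<longlonglongrightarrow> 0" unfolding X_def by (rule LIMSEQ_inverse_real_of_nat)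
  have step: "(\<integral>z. (f (Z (fst z) + X n *\<^sub>R Z (snd z)) - f (Z (fst z))) / X n * Z (snd z) $ i \<partial>?P)
      = (\<integral>z. f (Z (fst z) + X n *\<^sub>R Z (snd z)) * Z (fst z) $ i \<partial>?P)" for n
  proof -
    have "0 = (\<integral>z. f (Z (fst z) + X n *\<^sub>R Z (snd z)) * Z (snd z) $ i
        - X n * (f (Z (fst z) + X n *\<^sub>R Z (snd z)) * Z (fst z) $ i) \<partial>?P)"
      using rotation_orthogonality[of f "X n" i] by (simp add: case_prod_beta' algebra_simps)
    also have "\<dots> = (\<integral>z. f (Z (fst z) + X n *\<^sub>R Z (snd z)) * Z (snd z) $ i \<partial>?P)
        - X n * (\<integral>z. f (Z (fst z) + X n *\<^sub>R Z (snd z)) * Z (fst z) $ i \<partial>?P)"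
      using i1[OF X(2)] i2[OF X(2)] by simp
    finally have e: "(\<integral>z. f (Z (fst z) + X n *\<^sub>R Z (snd z)) * Z (snd z) $ i \<partial>?P)
        = X n * (\<integral>z. f (Z (fst z) + X n *\<^sub>R Z (snd z)) * Z (fst z) $ i \<partial>?P)" by simp
    have "(\<integral>z. (f (Z (fst z) + X n *\<^sub>R Z (snd z)) - f (Z (fst z))) / X n * Z (snd z) $ i \<partial>?P)
       = (\<integral>z. (f (Z (fst z) + X n *\<^sub>R Z (snd z)) * Z (snd z) $ i - f (Z (fst z)) * Z (snd z) $ i) / X n \<partial>?P)"
      by (simp add: algebra_simps diff_divide_distrib)
    also have "\<dots> = ((\<integral>z. f (Z (fst z) + X n *\<^sub>R Z (snd z)) * Z (snd z) $ i \<partial>?P) - 0) / X n"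
      using i2[OF X(2)] i2[of 0] z0 by simp
    finally show ?thesis using e X(1)[of n] by simp
  qed
  have dom: "integrable ?P (\<lambda>z. C * (1 + (norm (Z (fst z)))\<^sup>2 + (norm (Z (snd z)))\<^sup>2))"
    by (rule quad[of _ C]) (use C0 in auto)
  \<comment> \<open>The Lipschitz constant bounds the difference quotient by \<open>L\<close> times
    the norm of the second copy, whatever the step.\<close>
  have dom2: "integrable ?P (\<lambda>z. L * (norm (Z (snd z)))\<^sup>2)"
    by (rule quad[of _ L]) (use L0 in \<open>auto simp: abs_mult algebra_simps\<close>)
  have lim1: "(\<lambda>n. \<integral>z. f (Z (fst z) + X n *\<^sub>R Z (snd z)) * Z (fst z) $ i \<partial>?P)
      \<longlonglongrightarrow> (\<integral>z. f (Z (fst z)) * Z (fst z) $ i \<partial>?P)"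
  proof (rule integral_dominated_convergence[OF _ _ dom])
    show "AE z in ?P. (\<lambda>n. f (Z (fst z) + X n *\<^sub>R Z (snd z)) * Z (fst z) $ i) \<longlonglongrightarrow> f (Z (fst z)) * Z (fst z) $ i"
    proof (rule AE_I2)
      fix z :: "'b \<times> 'b"
      have "isCont f (Z (fst z))" using f by (rule differentiable_imp_continuous_within)
      moreover have "(\<lambda>n. Z (fst z) + X n *\<^sub>R Z (snd z)) \<longlonglongrightarrow> Z (fst z) + 0 *\<^sub>R Z (snd z)"
        by (intro tendsto_intros X0)
      ultimately have "(\<lambda>n. f (Z (fst z) + X n *\<^sub>R Z (snd z))) \<longlonglongrightarrow> f (Z (fst z))"
        using isCont_tendsto_compose[of "Z (fst z)" f] by simp
      then show "(\<lambda>n. f (Z (fst z) + X n *\<^sub>R Z (snd z)) * Z (fst z) $ i) \<longlonglongrightarrow> f (Z (fst z)) * Z (fst z) $ i"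
        by (intro tendsto_intros)
    qed
    show "AE z in ?P. norm (f (Z (fst z) + X n *\<^sub>R Z (snd z)) * Z (fst z) $ i)
        \<le> C * (1 + (norm (Z (fst z)))\<^sup>2 + (norm (Z (snd z)))\<^sup>2)" for n
      using bound1[OF X(2)] by auto
  qed measurable
  have lim2: "(\<lambda>n. \<integral>z. (f (Z (fst z) + X n *\<^sub>R Z (snd z)) - f (Z (fst z))) / X n * Z (snd z) $ i \<partial>?P)
      \<longlonglongrightarrow> (\<integral>z. (\<Sum>j\<in>UNIV. Z (snd z) $ j * partial j f (Z (fst z))) * Z (snd z) $ i \<partial>?P)"
  proof (rule integral_dominated_convergence[OF _ _ dom2])
    show "AE z in ?P. (\<lambda>n. (f (Z (fst z) + X n *\<^sub>R Z (snd z)) - f (Z (fst z))) / X n * Z (snd z) $ i)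
       \<longlonglongrightarrow> (\<Sum>j\<in>UNIV. Z (snd z) $ j * partial j f (Z (fst z))) * Z (snd z) $ i"
    proof (rule AE_I2)
      fix z :: "'b \<times> 'b"
      have "((\<lambda>t. f (Z (fst z) + t *\<^sub>R Z (snd z))) has_real_derivative (\<Sum>j\<in>UNIV. Z (snd z) $ j * partial j f (Z (fst z)))) (at 0)"
        using DERIV_line[of f "Z (fst z)" 0 "Z (snd z)"] f by simp
      then have "((\<lambda>t. (f (Z (fst z) + t *\<^sub>R Z (snd z)) - f (Z (fst z))) / t) \<longlongrightarrow> (\<Sum>j\<in>UNIV. Z (snd z) $ j * partial j f (Z (fst z)))) (at 0)"
        by (simp add: DERIV_def)
      then have "(\<lambda>n. (f (Z (fst z) + X n *\<^sub>R Z (snd z)) - f (Z (fst z))) / X n) \<longlonglongrightarrow> (\<Sum>j\<in>UNIV. Z (snd z) $ j * partial j f (Z (fst z)))"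
        unfolding tendsto_at_iff_sequentially o_def using X0 X(1) by (auto simp: less_imp_neq[symmetric])
      then show "(\<lambda>n. (f (Z (fst z) + X n *\<^sub>R Z (snd z)) - f (Z (fst z))) / X n * Z (snd z) $ i)
       \<longlonglongrightarrow> (\<Sum>j\<in>UNIV. Z (snd z) $ j * partial j f (Z (fst z))) * Z (snd z) $ i"
        by (intro tendsto_intros)
    qed
    show "AE z in ?P. norm ((f (Z (fst z) + X n *\<^sub>R Z (snd z)) - f (Z (fst z))) / X n * Z (snd z) $ i) \<le> L * (norm (Z (snd z)))\<^sup>2" for n
    proof (rule AE_I2)
      fix z :: "'b \<times> 'b"
      have "\<bar>(f (Z (fst z) + X n *\<^sub>R Z (snd z)) - f (Z (fst z))) / X n\<bar> \<le> L * norm (Z (snd z))"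
        using lip[of "Z (fst z)" "X n *\<^sub>R Z (snd z)"] X(1)[of n] by (simp add: field_simps)
      from mult_mono[OF this comp] L0
      show "norm ((f (Z (fst z) + X n *\<^sub>R Z (snd z)) - f (Z (fst z))) / X n * Z (snd z) $ i) \<le> L * (norm (Z (snd z)))\<^sup>2"
        by (simp add: abs_mult power2_eq_square mult.assoc)
    qed
  qed measurable
  have "(\<integral>z. f (Z (fst z)) * Z (fst z) $ i \<partial>?P) = (\<integral>z. (\<Sum>j\<in>UNIV. Z (snd z) $ j * partial j f (Z (fst z))) * Z (snd z) $ i \<partial>?P)"
    using LIMSEQ_unique[OF lim1[folded step] lim2] .
  moreover have "(\<integral>z. f (Z (fst z)) * Z (fst z) $ i \<partial>?P) = (\<integral>x. Z x $ i * f (Z x) \<partial>N)"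
    using P.integral_fst'[OF i1[of 0]] by (simp add: prob_space mult.commute)
  moreover have "(\<integral>z. (\<Sum>j\<in>UNIV. Z (snd z) $ j * partial j f (Z (fst z))) * Z (snd z) $ i \<partial>?P)
      = (\<Sum>j\<in>UNIV. S $ i $ j * (\<integral>x. partial j f (Z x) \<partial>N))"
  proof -
    have ij: "integrable ?P (\<lambda>z. partial j f (Z (fst z)) * (Z (snd z) $ i * Z (snd z) $ j))" for j
    proof (rule quad[of _ K])
      fix x y
      have "\<bar>Z y $ i * Z y $ j\<bar> \<le> norm (Z y) * norm (Z y)"
        unfolding abs_mult by (intro mult_mono comp) auto
      also have "\<dots> \<le> 1 + (norm (Z x))\<^sup>2 + (norm (Z y))\<^sup>2" by (simp add: power2_eq_square)
      finally show "\<bar>partial j f (Z (fst (x, y))) * (Z (snd (x, y)) $ i * Z (snd (x, y)) $ j)\<bar> \<le> K * (1 + (norm (Z x))\<^sup>2 + (norm (Z y))\<^sup>2)"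
        unfolding fst_conv snd_conv abs_mult[of "partial j f (Z x)"]
        by (intro mult_mono K) (use \<open>0 \<le> K\<close> in auto)
    qed measurable
    have "(\<integral>z. (\<Sum>j\<in>UNIV. Z (snd z) $ j * partial j f (Z (fst z))) * Z (snd z) $ i \<partial>?P)
      = (\<integral>z. (\<Sum>j\<in>UNIV. partial j f (Z (fst z)) * (Z (snd z) $ i * Z (snd z) $ j)) \<partial>?P)"
      by (simp add: sum_distrib_left sum_distrib_right mult_ac)
    also have "\<dots> = (\<Sum>j\<in>UNIV. \<integral>z. partial j f (Z (fst z)) * (Z (snd z) $ i * Z (snd z) $ j) \<partial>?P)"
      using ij by (intro Bochner_Integration.integral_sum) auto
    also have "\<dots> = (\<Sum>j\<in>UNIV. S $ i $ j * (\<integral>x. partial j f (Z x) \<partial>N))"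
    proof (rule sum.cong[OF refl])
      fix j
      show "(\<integral>z. partial j f (Z (fst z)) * (Z (snd z) $ i * Z (snd z) $ j) \<partial>?P) = S $ i $ j * (\<integral>x. partial j f (Z x) \<partial>N)"
        using P.integral_fst'[OF ij[of j]] unfolding mult.commute[of "S $ i $ j"]
        by (simp add: expectation_component_product)
    qed
    finally show ?thesis .
  qed
  ultimately show ?thesis by simp
qed

end

subsection \<open>Differentiation under the integral and conditional variances\<close>

text \<open>Dominated convergence along an arbitrary null sequence: by the mean value inequality the
  bound \<open>B\<close> on the derivative, uniform in \<open>t\<close>, also bounds every
  difference quotient.\<close>

lemma has_real_derivative_integral:
  fixes F F' :: "real \<Rightarrow> 'a \<Rightarrow> real"
  assumes der: "\<And>t x. ((\<lambda>t. F t x) has_real_derivative F' t x) (at t)"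
    and int: "\<And>t. integrable M (F t)" and F': "\<And>t. F' t \<in> borel_measurable M"
    and B: "integrable M B" "\<And>t x. \<bar>F' t x\<bar> \<le> B x"
  shows "((\<lambda>t. \<integral>x. F t x \<partial>M) has_real_derivative (\<integral>x. F' t x \<partial>M)) (at t)"
  unfolding DERIV_def tendsto_at_iff_sequentially o_def
proof (intro allI impI)
  fix X :: "nat \<Rightarrow> real" assume X: "\<forall>n. X n \<in> UNIV - {0}" "X \<longlonglongrightarrow> 0"
  have "(\<lambda>n. \<integral>x. (F (t + X n) x - F t x) / X n \<partial>M) \<longlonglongrightarrow> (\<integral>x. F' t x \<partial>M)"
  proof (rule integral_dominated_convergence[OF F' _ B(1)])
    show "(\<lambda>x. (F (t + X n) x - F t x) / X n) \<in> borel_measurable M" for n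
      using int by (intro borel_measurable_divide borel_measurable_diff) auto
    show "AE x in M. (\<lambda>n. (F (t + X n) x - F t x) / X n) \<longlonglongrightarrow> F' t x"
      using der[of _ t] X unfolding DERIV_def tendsto_at_iff_sequentially o_def by auto
    show "AE x in M. norm ((F (t + X n) x - F t x) / X n) \<le> B x" for n
    proof (rule AE_I2)
      fix x
      have "norm (F (t + X n) x - F t x) \<le> B x * norm (t + X n - t)"
        using B(2) by (intro field_differentiable_bound[of UNIV "\<lambda>t. F t x" "\<lambda>t. F' t x"])
          (auto intro: der has_field_derivative_at_within)
      then show "norm ((F (t + X n) x - F t x) / X n) \<le> B x"
        using X(1) by (simp add: abs_divide divide_le_eq)
    qed
  qed
  then show "(\<lambda>n. ((\<integral>x. F (t + X n) x \<partial>M) - (\<integral>x. F t x \<partial>M)) / X n) \<longlonglongrightarrow> (\<integral>x. F' t x \<partial>M)"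
    using int by simp
qed

lemma DERIV_circle:
  fixes f :: "real^'d::finite \<Rightarrow> real"
  assumes f: "\<And>x. f differentiable (at x)"
  shows "((\<lambda>t. f (sin t *\<^sub>R a + cos t *\<^sub>R b)) has_real_derivative
     (\<Sum>j\<in>UNIV. (cos t * a $ j - sin t * b $ j) * partial j f (sin t *\<^sub>R a + cos t *\<^sub>R b))) (at t)"
proof -
  let ?y = "sin t *\<^sub>R a + cos t *\<^sub>R b"
  let ?D = "frechet_derivative f (at ?y)"
  let ?v = "cos t *\<^sub>R a - sin t *\<^sub>R b"
  have D: "(f has_derivative ?D) (at ?y)"
    using f frechet_derivative_works by blast
  have "((\<lambda>t. sin t *\<^sub>R a + cos t *\<^sub>R b) has_derivative (\<lambda>h. h *\<^sub>R ?v)) (at t)"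
    by (auto intro!: derivative_eq_intros simp: fun_eq_iff algebra_simps)
  from diff_chain_at[OF this D]
  have "((\<lambda>t. f (sin t *\<^sub>R a + cos t *\<^sub>R b)) has_derivative (\<lambda>h. ?D (h *\<^sub>R ?v))) (at t)"
    by (simp add: o_def)
  moreover have "?D (h *\<^sub>R ?v) = ?D ?v * h" for h
    using linear_frechet_derivative[OF f] by (simp add: linear_cmul)
  ultimately have "((\<lambda>t. f (sin t *\<^sub>R a + cos t *\<^sub>R b)) has_real_derivative ?D ?v) (at t)"
    unfolding has_field_derivative_def by (simp add: mult.commute[of _ "?D ?v"])
  then show ?thesis by (simp add: frechet_eq_sum_partial[OF f])
qed

text \<open>The variance of the absolute centred variable is nonnegative; this is the Cauchy-Schwarz
  step from first to second absolute moment.\<close>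

lemma (in prob_space) expectation_abs_centred_le_sqrt_Var:
  assumes Y: "integrable M Y" "integrable M (\<lambda>x. (Y x)\<^sup>2)"
  shows "(\<integral>x. \<bar>Y x - (\<integral>y. Y y \<partial>M)\<bar> \<partial>M) \<le> sqrt (Var M Y)"
proof -
  let ?C = "\<lambda>x. \<bar>Y x - (\<integral>y. Y y \<partial>M)\<bar>"
  have i: "integrable M ?C" using Y by auto
  have i2: "integrable M (\<lambda>x. (?C x)\<^sup>2)"
    using Y by (simp add: power2_diff)
  have "0 \<le> variance ?C" by simp
  also have "variance ?C = (\<integral>x. (?C x)\<^sup>2 \<partial>M) - (\<integral>x. ?C x \<partial>M)\<^sup>2"
    by (rule variance_eq[OF i i2])
  finally have "(\<integral>x. ?C x \<partial>M)\<^sup>2 \<le> Var M Y" by (simp add: Var_def)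
  then show ?thesis by (rule real_le_rsqrt)
qed

lemma integrable_mult_bounded:
  fixes X V :: "'a \<Rightarrow> real"
  assumes X: "integrable M X" and V: "V \<in> borel_measurable M" "\<And>x. \<bar>V x\<bar> \<le> B"
  shows "integrable M (\<lambda>x. X x * V x)"
proof (rule Bochner_Integration.integrable_bound)
  show "integrable M (\<lambda>x. \<bar>X x\<bar> * B)" using X by simp
  show "(\<lambda>x. X x * V x) \<in> borel_measurable M" using X V(1) by measurable
  show "AE x in M. norm (X x * V x) \<le> norm (\<bar>X x\<bar> * B)"
    using order_trans[OF V(2) abs_ge_self] by (auto simp: abs_mult intro!: mult_left_mono)
qed

text \<open>Since \<open>V (W x)\<close> is measurable for the conditioning algebra,
  \<open>X\<close> may be replaced by its conditional expectation. Centring that factor and pulling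
  out \<open>B\<close> before squaring leaves the standard deviation of the conditional expectation
  rather than that of \<open>X\<close>. Square integrability makes the Bochner integral in
  \<open>Var\<close> a true variance.\<close>

lemma covariance_le_sqrt_Var_cond_exp:
  fixes W :: "'a \<Rightarrow> real^'d::finite" and V :: "real^'d \<Rightarrow> real"
  assumes M: "prob_space M" and [measurable]: "W \<in> borel_measurable M" "V \<in> borel_measurable borel"
    and X: "integrable M X" and Y: "integrable M (\<lambda>x. (cond_exp_given M W X x)\<^sup>2)"
    and B: "\<And>w. \<bar>V w\<bar> \<le> B"
  shows "\<bar>(\<integral>x. X x * V (W x) \<partial>M) - (\<integral>x. X x \<partial>M) * (\<integral>x. V (W x) \<partial>M)\<bar>
      \<le> B * sqrt (Var M (cond_exp_given M W X))"
proof -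
  interpret prob_space M by fact
  let ?F = "vimage_algebra (space M) W borel"
  let ?Y = "cond_exp_given M W X"
  have sub: "subalgebra M ?F"
    unfolding subalgebra_def using measurable_sets[OF assms(2)]
    by (auto simp: sets_vimage_algebra2)
  interpret finite_measure_subalgebra M ?F by standard (rule sub)
  have [measurable]: "X \<in> borel_measurable M" using X by auto
  have WF: "W \<in> ?F \<rightarrow>\<^sub>M borel" by (rule measurable_vimage_algebra1) auto
  have VF: "(\<lambda>x. V (W x)) \<in> borel_measurable ?F" using WF by measurable
  have XV: "integrable M (\<lambda>x. V (W x) * X x)"
    using integrable_mult_bounded[OF X, of "\<lambda>x. V (W x)" B] B by (simp add: mult.commute)
  have Vi: "integrable M (\<lambda>x. V (W x))"
    by (rule integrable_const_bound[of _ B]) (use B in auto)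
  have Yi: "integrable M ?Y" and YX: "(\<integral>x. ?Y x \<partial>M) = (\<integral>x. X x \<partial>M)"
    unfolding cond_exp_given_def using X by (auto intro: real_cond_exp_int)
  have VY: "integrable M (\<lambda>x. V (W x) * ?Y x)"
    and eq: "(\<integral>x. V (W x) * ?Y x \<partial>M) = (\<integral>x. V (W x) * X x \<partial>M)"
    unfolding cond_exp_given_def using XV VF by (intro real_cond_exp_intg; simp)+
  have "(\<integral>x. X x * V (W x) \<partial>M) - (\<integral>x. X x \<partial>M) * (\<integral>x. V (W x) \<partial>M)
      = (\<integral>x. V (W x) * (?Y x - (\<integral>y. ?Y y \<partial>M)) \<partial>M)"
    using VY Vi eq YX by (simp add: right_diff_distrib mult.commute)
  also have "\<bar>\<dots>\<bar> \<le> (\<integral>x. B * \<bar>?Y x - (\<integral>y. ?Y y \<partial>M)\<bar> \<partial>M)"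
  proof (rule order_trans[OF integral_abs_bound integral_mono])
    show "integrable M (\<lambda>x. \<bar>V (W x) * (?Y x - (\<integral>y. ?Y y \<partial>M))\<bar>)"
      using VY Vi by (simp add: right_diff_distrib)
    show "integrable M (\<lambda>x. B * \<bar>?Y x - (\<integral>y. ?Y y \<partial>M)\<bar>)"
      using Yi by simp
    show "\<bar>V (W x) * (?Y x - (\<integral>y. ?Y y \<partial>M))\<bar> \<le> B * \<bar>?Y x - (\<integral>y. ?Y y \<partial>M)\<bar>" for x
      unfolding abs_mult using B by (rule mult_right_mono) simp
  qed
  also have "\<dots> \<le> B * sqrt (Var M ?Y)"
  proof -
    have "0 \<le> B" using B[of undefined] by linarith
    then show ?thesis
      using expectation_abs_centred_le_sqrt_Var[OF Yi Y] by (simp add: mult_left_mono)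
  qed
  finally show ?thesis .
qed

subsection \<open>Stein couplings\<close>

locale stein_pair = prob_space M for M :: "'a measure" +
  fixes W W' G :: "'a \<Rightarrow> real^'d::finite"
  assumes W_measurable [measurable]: "W \<in> borel_measurable M"
    and W'_measurable [measurable]: "W' \<in> borel_measurable M"
    and G_measurable [measurable]: "G \<in> borel_measurable M"
    and stein: "stein_coupling M W W' G"
    and W_square: "\<And>j. integrable M (\<lambda>x. (W x $ j)\<^sup>2)"
begin

text \<open>Stated per component, so that test functions with a single nonzero component can be
  inserted to extract scalar identities.\<close>

lemma stein_identity:
  fixes g :: "'d \<Rightarrow> real^'d \<Rightarrow> real"
  assumes [measurable]: "\<And>i. g i \<in> borel_measurable borel"
    and "\<And>i. integrable M (\<lambda>x. G x $ i * (g i (W' x) - g i (W x)))"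
    and "\<And>i. integrable M (\<lambda>x. W x $ i * g i (W x))"
  shows "(\<Sum>i\<in>UNIV. \<integral>x. G x $ i * (g i (W' x) - g i (W x)) \<partial>M) = (\<Sum>i\<in>UNIV. \<integral>x. W x $ i * g i (W x) \<partial>M)"
proof -
  let ?g = "\<lambda>w. \<chi> i. g i w"
  have 1: "?g \<in> borel_measurable borel"
    by (subst borel_measurable_euclidean_space) (auto simp: Basis_vec_def inner_axis)
  have e1: "G x \<bullet> ?g (W' x) - G x \<bullet> ?g (W x) = (\<Sum>i\<in>UNIV. G x $ i * (g i (W' x) - g i (W x)))" for x
    by (simp add: inner_vec_def sum_subtractf right_diff_distrib)
  have e2: "W x \<bullet> ?g (W x) = (\<Sum>i\<in>UNIV. W x $ i * g i (W x))" for x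
    by (simp add: inner_vec_def)
  have "(\<integral>x. G x \<bullet> ?g (W' x) - G x \<bullet> ?g (W x) \<partial>M) = (\<integral>x. W x \<bullet> ?g (W x) \<partial>M)"
  proof (rule stein[unfolded stein_coupling_def, rule_format, OF 1])
    show "integrable M (\<lambda>x. G x \<bullet> ?g (W' x) - G x \<bullet> ?g (W x))"
      unfolding e1 using assms by simp
    show "integrable M (\<lambda>x. W x \<bullet> ?g (W x))"
      unfolding e2 using assms by simp
  qed
  then show ?thesis unfolding e1 e2 using assms by simp
qed

lemma W_norm_square: "integrable M (\<lambda>x. (norm (W x))\<^sup>2)"
  by (intro integrable_norm_sq W_square)

lemma W_norm: "integrable M (\<lambda>x. norm (W x))"
  by (intro integrable_norm_of_square W_norm_square prob_space_axioms) simp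

lemma W_component: "integrable M (\<lambda>x. W x $ i)"
  by (rule Bochner_Integration.integrable_bound[OF W_norm]) (auto simp: component_le_norm_cart)

lemma W_product: "integrable M (\<lambda>x. W x $ i * W x $ j)"
proof (rule Bochner_Integration.integrable_bound[OF W_norm_square])
  show "AE x in M. norm (W x $ i * W x $ j) \<le> norm ((norm (W x))\<^sup>2)"
    unfolding power2_eq_square
    by (auto simp: abs_mult intro!: mult_mono component_le_norm_cart)
qed measurable

lemma W_centred: "(\<integral>x. W x $ i \<partial>M) = 0"
proof -
  have "(\<Sum>k\<in>UNIV. \<integral>x. W x $ k * (if k = i then 1 else 0) \<partial>M) = 0"
    using stein_identity[of "\<lambda>k w. if k = i then 1 else 0"] W_component by simp
  also have "(\<Sum>k\<in>UNIV. \<integral>x. W x $ k * (if k = i then 1 else 0) \<partial>M)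
      = (\<Sum>k\<in>UNIV. if k = i then \<integral>x. W x $ k \<partial>M else 0)"
    by (intro sum.cong) auto
  finally show ?thesis by simp
qed

lemma cov_matrix_nth: "cov_matrix M W $ i $ j = (\<integral>x. W x $ i * W x $ j \<partial>M)"
  by (simp add: cov_matrix_def W_centred)

lemma cov_matrix_stein:
  assumes "integrable M (\<lambda>x. G x $ i * (W' x $ j - W x $ j))"
  shows "(\<integral>x. G x $ i * (W' x $ j - W x $ j) \<partial>M) = cov_matrix M W $ i $ j"
proof -
  let ?g = "\<lambda>k w :: real^'d. if k = i then w $ j else 0"
  have "(\<Sum>k\<in>UNIV. \<integral>x. G x $ k * (?g k (W' x) - ?g k (W x)) \<partial>M) = (\<Sum>k\<in>UNIV. \<integral>x. W x $ k * ?g k (W x) \<partial>M)"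
  proof (rule stein_identity)
    fix k
    show "?g k \<in> borel_measurable borel" by measurable
    show "integrable M (\<lambda>x. G x $ k * (?g k (W' x) - ?g k (W x)))" using assms by (cases "k = i") auto
    show "integrable M (\<lambda>x. W x $ k * ?g k (W x))" using W_product by (cases "k = i") auto
  qed
  moreover have "(\<integral>x. G x $ k * (?g k (W' x) - ?g k (W x)) \<partial>M) = (if k = i then \<integral>x. G x $ i * (W' x $ j - W x $ j) \<partial>M else 0)" for k
    by simp
  moreover have "(\<integral>x. W x $ k * ?g k (W x) \<partial>M) = (if k = i then \<integral>x. W x $ i * W x $ j \<partial>M else 0)" for k
    by simp
  ultimately show ?thesis by (simp add: cov_matrix_nth)
qed

text \<open>The quadratic form is the expectation of the square of
  \<open>u \<bullet> W\<close>.\<close>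

lemma cov_matrix_psd: "u \<bullet> (cov_matrix M W *v u) \<ge> 0"
proof -
  have "u \<bullet> (cov_matrix M W *v u) = (\<Sum>i\<in>UNIV. \<Sum>j\<in>UNIV. \<integral>x. (u $ i * W x $ i) * (u $ j * W x $ j) \<partial>M)"
  proof -
    have "(\<integral>x. (u $ i * W x $ i) * (u $ j * W x $ j) \<partial>M) = u $ i * u $ j * (\<integral>x. W x $ i * W x $ j \<partial>M)" for i j
      by (subst integral_mult_right_zero[symmetric]) (simp add: mult_ac)
    then show ?thesis
      by (simp add: inner_vec_def matrix_vector_mult_def cov_matrix_nth sum_distrib_left mult_ac)
  qed
  also have "\<dots> = (\<integral>x. (\<Sum>i\<in>UNIV. \<Sum>j\<in>UNIV. (u $ i * W x $ i) * (u $ j * W x $ j)) \<partial>M)"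
  proof -
    have "integrable M (\<lambda>x. (u $ i * W x $ i) * (u $ j * W x $ j))" for i j
    proof -
      have "integrable M (\<lambda>x. (u $ i * u $ j) * (W x $ i * W x $ j))" using W_product by simp
      then show ?thesis by (simp add: mult_ac)
    qed
    then show ?thesis by simp
  qed
  also have "\<dots> = (\<integral>x. (\<Sum>i\<in>UNIV. u $ i * W x $ i)\<^sup>2 \<partial>M)"
    by (simp add: power2_eq_square sum_product)
  also have "\<dots> \<ge> 0" by (rule Bochner_Integration.integral_nonneg) simp
  finally show ?thesis .
qed

lemma gaussian_vector_cov:
  assumes "centred_gaussian N Z (cov_matrix M W)"
  shows "gaussian_vector N Z (cov_matrix M W)"
proof -
  have "prob_space N" using assms by (simp add: centred_gaussian_def)
  then show ?thesis
    using assms cov_matrix_psd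
    by (simp add: gaussian_vector_def gaussian_vector_axioms_def cov_matrix_nth mult.commute)
qed

end

subsection \<open>Interpolation between the two laws\<close>

lemma pderiv_mi_measurable:
  assumes "k_times_differentiable k f" "mi_abs \<alpha> < k"
  shows "pderiv_mi \<alpha> f \<in> borel_measurable borel"
  using pderiv_mi_differentiable[OF assms] by (rule borel_measurable_differentiable)

lemma abs_pderiv_mi_le_sup_norm:
  assumes "bounded (range (pderiv_mi \<beta> f))"
  shows "\<bar>pderiv_mi \<beta> f x\<bar> \<le> sup_norm_mi f \<beta>"
proof -
  obtain B where "\<And>x. norm (pderiv_mi \<beta> f x) \<le> B"
    using assms unfolding bounded_iff by auto
  then have "bdd_above (range (\<lambda>x. \<bar>pderiv_mi \<beta> f x\<bar>))" by (auto intro!: bdd_aboveI2)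
  then show ?thesis unfolding sup_norm_mi_def by (rule cSUP_upper[rotated]) simp
qed

lemma differentiable_affine:
  fixes f :: "real^'d::finite \<Rightarrow> real"
  assumes f: "\<And>x. f differentiable (at x)"
  shows "(\<lambda>z. f (y + c *\<^sub>R z)) differentiable (at x)"
    and "partial k (\<lambda>z. f (y + c *\<^sub>R z)) x = c * partial k f (y + c *\<^sub>R x)"
proof -
  have "(\<lambda>z. y + c *\<^sub>R z) differentiable (at x)" by (auto intro!: derivative_intros)
  from differentiable_chain_at[OF this f]
  show "(\<lambda>z. f (y + c *\<^sub>R z)) differentiable (at x)" by (simp add: o_def)
  have "((\<lambda>t. f ((y + c *\<^sub>R x) + t *\<^sub>R (c *\<^sub>R axis k 1))) has_real_derivative
     (\<Sum>j\<in>UNIV. (c *\<^sub>R axis k 1) $ j * partial j f ((y + c *\<^sub>R x) + 0 *\<^sub>R (c *\<^sub>R axis k 1)))) (at 0)"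
    by (intro DERIV_line f)
  moreover have "(\<Sum>j\<in>UNIV. (c *\<^sub>R axis k 1) $ j * partial j f ((y + c *\<^sub>R x) + 0 *\<^sub>R (c *\<^sub>R axis k 1)))
      = c * partial k f (y + c *\<^sub>R x)"
    by (simp add: axis_def if_distrib[of "\<lambda>a. a * _"] if_distrib[of "\<lambda>a. _ * a"] cong: if_cong)
  ultimately have "((\<lambda>t. f ((y + c *\<^sub>R x) + t *\<^sub>R (c *\<^sub>R axis k 1))) has_real_derivative c * partial k f (y + c *\<^sub>R x)) (at 0)"
    by simp
  from DERIV_imp_deriv[OF this]
  show "partial k (\<lambda>z. f (y + c *\<^sub>R z)) x = c * partial k f (y + c *\<^sub>R x)"
    unfolding partial_def by (simp add: algebra_simps)
qed

text \<open>Bounds on \<open>h\<close> start at order 2, since \<alpha> + e_i has at least that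
  order. Going back from the second derivatives gives linear growth here and quadratic growth of
  \<open>h\<close> in \<open>quadratic_growth\<close>, which is what second moments can
  dominate.\<close>

lemma gradient_linear_growth:
  fixes h :: "real^'d::finite \<Rightarrow> real"
  assumes "\<And>i x. partial i h differentiable (at x)" "\<And>i j x. \<bar>partial j (partial i h) x\<bar> \<le> K"
  obtains A where "A \<ge> 0" "\<And>i y. \<bar>partial i h y\<bar> \<le> A * (1 + norm y)"
proof
  define A where "A = (\<Sum>i\<in>UNIV. \<bar>partial i h 0\<bar>) + real CARD('d) * K"
  have K0: "0 \<le> K" using assms(2)[of undefined undefined undefined] by linarith
  then show "A \<ge> 0" by (simp add: A_def sum_nonneg)
  fix i y
  have "\<bar>partial i h 0\<bar> \<le> (\<Sum>i\<in>UNIV. \<bar>partial i h 0\<bar>)" by (intro member_le_sum) auto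
  moreover have "\<bar>partial i h y - partial i h 0\<bar> \<le> real CARD('d) * K * norm y"
    using lipschitz_partial_bound[of "partial i h" K 0 y] assms by simp
  moreover have "A * (1 + norm y) = (\<Sum>i\<in>UNIV. \<bar>partial i h 0\<bar>) + (\<Sum>i\<in>UNIV. \<bar>partial i h 0\<bar>) * norm y
      + real CARD('d) * K + real CARD('d) * K * norm y"
    by (simp add: A_def algebra_simps)
  moreover have "0 \<le> (\<Sum>i\<in>UNIV. \<bar>partial i h 0\<bar>) * norm y" "0 \<le> real CARD('d) * K"
    using K0 by (auto simp: sum_nonneg)
  ultimately show "\<bar>partial i h y\<bar> \<le> A * (1 + norm y)" by linarith
qed

lemma quadratic_growth:
  fixes h :: "real^'d::finite \<Rightarrow> real"
  assumes h: "\<And>x. h differentiable (at x)" and A: "A \<ge> 0" "\<And>i y. \<bar>partial i h y\<bar> \<le> A * (1 + norm y)"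
  obtains B where "B \<ge> 0" "\<And>y. \<bar>h y\<bar> \<le> B * (1 + (norm y)\<^sup>2)"
proof
  define B where "B = \<bar>h 0\<bar> + 2 * real CARD('d) * A"
  show "B \<ge> 0" using A by (simp add: B_def)
  fix y
  have "((\<lambda>t. h (0 + t *\<^sub>R y)) has_real_derivative (\<Sum>j\<in>UNIV. y $ j * partial j h (0 + t *\<^sub>R y))) (at t)" for t
    by (intro DERIV_line h)
  then obtain t where t: "0 < t" "t < 1" "h (0 + 1 *\<^sub>R y) - h (0 + 0 *\<^sub>R y) = (1 - 0) * (\<Sum>j\<in>UNIV. y $ j * partial j h (0 + t *\<^sub>R y))"
    using MVT2[of 0 1 "\<lambda>t. h (0 + t *\<^sub>R y)" "\<lambda>t. \<Sum>j\<in>UNIV. y $ j * partial j h (0 + t *\<^sub>R y)"] by auto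
  have ty: "norm (0 + t *\<^sub>R y) \<le> norm y" using t mult_right_mono[of t 1 "norm y"] by simp
  have "\<bar>\<Sum>j\<in>UNIV. y $ j * partial j h (0 + t *\<^sub>R y)\<bar> \<le> (\<Sum>j\<in>(UNIV::'d set). norm y * (A * (1 + norm y)))"
  proof (intro order_trans[OF sum_abs] sum_mono)
    fix j
    have "\<bar>partial j h (0 + t *\<^sub>R y)\<bar> \<le> A * (1 + norm y)"
      by (rule order_trans[OF A(2)]) (use ty A(1) in \<open>auto intro!: mult_left_mono\<close>)
    then show "\<bar>y $ j * partial j h (0 + t *\<^sub>R y)\<bar> \<le> norm y * (A * (1 + norm y))"
      unfolding abs_mult by (intro mult_mono component_le_norm_cart) auto
  qed
  also have "\<dots> = real CARD('d) * A * (norm y + (norm y)\<^sup>2)" by (simp add: power2_eq_square algebra_simps)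
  also have "\<dots> \<le> real CARD('d) * A * (2 * (1 + (norm y)\<^sup>2))"
    using A(1) le_one_plus_square[of "norm y"] zero_le_power2[of "norm y"] by (intro mult_left_mono) auto
  finally have "\<bar>h y - h 0\<bar> \<le> 2 * real CARD('d) * A * (1 + (norm y)\<^sup>2)" using t by (simp add: algebra_simps)
  moreover have "\<bar>h 0\<bar> \<le> \<bar>h 0\<bar> * (1 + (norm y)\<^sup>2)"
    using mult_left_mono[of 1 "1 + (norm y)\<^sup>2" "\<bar>h 0\<bar>"] by simp
  ultimately show "\<bar>h y\<bar> \<le> B * (1 + (norm y)\<^sup>2)"
    unfolding B_def by (simp add: distrib_right)
qed

lemma norm_sin_cos_le:
  "norm (sin t *\<^sub>R a + cos t *\<^sub>R b) \<le> norm a + norm (b :: 'a::real_normed_vector)"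
proof -
  have "\<bar>sin t\<bar> * norm a \<le> 1 * norm a" "\<bar>cos t\<bar> * norm b \<le> 1 * norm b"
    by (intro mult_right_mono; simp)+
  then show ?thesis using norm_triangle_ineq[of "sin t *\<^sub>R a" "cos t *\<^sub>R b"] by simp
qed

lemma product_quadratic_bound:
  fixes a b c :: real
  assumes "a \<ge> 0" "b \<ge> 0" "c \<le> a + b" 
  shows "c * (1 + (a + b)) \<le> 4 * (1 + a\<^sup>2 + b\<^sup>2)"
proof -
  have "c * (1 + (a + b)) \<le> (a + b) * (1 + (a + b))"
    using assms by (intro mult_right_mono) auto
  also have "\<dots> \<le> 4 * (1 + a\<^sup>2 + b\<^sup>2)"
  proof -
    have e: "(a + b) * (1 + (a + b)) = a + b + a\<^sup>2 + b\<^sup>2 + 2 * (a * b)"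
      by (simp add: power2_eq_square algebra_simps)
    have "2 * (a * b) \<le> a\<^sup>2 + b\<^sup>2"
      using zero_le_power2[of "a - b"] by (simp add: power2_eq_square algebra_simps)
    \<comment> \<open>Abstracting the squares and the product as \<open>r\<close>, \<open>s\<close>
      and \<open>t\<close> leaves a linear inequality.\<close>
    moreover have lin: "a + b + r + s + 2 * t \<le> 4 * (1 + r + s)"
      if "2 * t \<le> r + s" "a \<le> 1 + r" "b \<le> 1 + s" "0 \<le> r" "0 \<le> s" for r s t :: real
      using that by simp
    ultimately show ?thesis unfolding e
      by (intro lin le_one_plus_square zero_le_power2)
  qed
  finally show ?thesis .
qed

text \<open>The boundedness and integrability assumptions say that the quantities on the right side
  of the bound are genuine: \<open>SUP\<close> over an unbounded set is unspecified, and a Bochner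
  integral that does not exist is 0. Order \<open>p + 2\<close> for \<open>h\<close> arises as order
  \<open>p + 1\<close> plus a unit.\<close>

locale stein_interpolation = stein_pair M W W' G
  for M :: "'a measure" and W W' G :: "'a \<Rightarrow> real^'d::finite" +
  fixes N :: "'b measure" and Z :: "'b \<Rightarrow> real^'d" and h :: "real^'d \<Rightarrow> real" and p :: nat
  assumes p: "p \<ge> 1"
    and gaussian: "centred_gaussian N Z (cov_matrix M W)"
    and h_smooth: "k_times_differentiable (p + 2) h"
    and h_bounded: "\<And>\<beta>. 2 \<le> mi_abs \<beta> \<Longrightarrow> mi_abs \<beta> \<le> p + 2 \<Longrightarrow> bounded (range (pderiv_mi \<beta> h))"
    and GD_integrable: "\<And>i \<alpha>. 1 \<le> mi_abs \<alpha> \<Longrightarrow> mi_abs \<alpha> \<le> p + 1 \<Longrightarrow>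
           integrable M (\<lambda>x. G x $ i * mi_pow (W' x - W x) \<alpha>)"
    and cond_exp_square: "\<And>i \<alpha>. 1 \<le> mi_abs \<alpha> \<Longrightarrow> mi_abs \<alpha> \<le> p \<Longrightarrow>
           integrable M (\<lambda>x. (cond_exp_given M W (\<lambda>y. G y $ i * mi_pow (W' y - W y) \<alpha>) x)\<^sup>2)"
begin

sublocale Zg: gaussian_vector N Z "cov_matrix M W"
  using gaussian by (rule gaussian_vector_cov)

sublocale P: pair_prob_space M N ..

abbreviation S where "S \<equiv> cov_matrix M W"

abbreviation nrm :: "'d \<Rightarrow> ('d \<Rightarrow> nat) \<Rightarrow> real" where
  "nrm i \<alpha> \<equiv> sup_norm_mi h (add_unit_mi \<alpha> i)"

abbreviation GD :: "'d \<Rightarrow> ('d \<Rightarrow> nat) \<Rightarrow> 'a \<Rightarrow> real" where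
  "GD i \<alpha> \<equiv> (\<lambda>x. G x $ i * mi_pow (W' x - W x) \<alpha>)"

text \<open>The parameters stand for \<open>sin t\<close> and \<open>cos t\<close>. The derivative
  is that of \<open>h\<close>, taken before averaging, so the powers of \<open>s\<close> from the
  chain rule stay visible in the Taylor sums.\<close>

definition V :: "real \<Rightarrow> real \<Rightarrow> ('d \<Rightarrow> nat) \<Rightarrow> real^'d \<Rightarrow> real" where
  "V s c \<beta> w = (\<integral>z. pderiv_mi \<beta> h (s *\<^sub>R w + c *\<^sub>R Z z) \<partial>N)"

definition g :: "real \<Rightarrow> real \<Rightarrow> 'd \<Rightarrow> real^'d \<Rightarrow> real" where
  "g s c i w = (\<integral>z. partial i h (s *\<^sub>R w + c *\<^sub>R Z z) \<partial>N)"

lemma h_smooth': "k \<le> p + 2 \<Longrightarrow> k_times_differentiable k h"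
  by (rule k_times_differentiable_mono[OF h_smooth])

lemma h_differentiable: "h differentiable (at x)"
  using pderiv_mi_differentiable[OF h_smooth, of "\<lambda>_. 0"] by (simp add: pderiv_mi_zero)

lemma partial_h_smooth: "k_times_differentiable (p + 1) (partial i h)"
  using h_smooth by (intro k_times_differentiable_partial) simp

lemma partial_h_differentiable: "partial i h differentiable (at x)"
  using pderiv_mi_differentiable[OF partial_h_smooth, of "\<lambda>_. 0"] by (simp add: pderiv_mi_zero)

lemma partial_h_measurable [measurable]: "partial i h \<in> borel_measurable borel"
  by (intro borel_measurable_differentiable partial_h_differentiable)

lemma h_measurable [measurable]: "h \<in> borel_measurable borel"
  by (intro borel_measurable_differentiable h_differentiable)

lemma pderiv_h_measurable: "mi_abs \<beta> \<le> p + 1 \<Longrightarrow> pderiv_mi \<beta> h \<in> borel_measurable borel"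
  by (rule pderiv_mi_measurable[OF h_smooth]) simp

lemma pderiv_h_bound: "2 \<le> mi_abs \<beta> \<Longrightarrow> mi_abs \<beta> \<le> p + 2 \<Longrightarrow> \<bar>pderiv_mi \<beta> h x\<bar> \<le> sup_norm_mi h \<beta>"
  by (rule abs_pderiv_mi_le_sup_norm[OF h_bounded])

text \<open>The units are added in this order so that the result has the form \<alpha> + e_i with
  \<alpha> = e_j, the one that occurs in the bound.\<close>

lemma partial2_eq: "partial j (partial i h) = pderiv_mi (add_unit_mi (add_unit_mi (\<lambda>_. 0) j) i) h"
  using pderiv_mi_unit[OF k_times_differentiable_mono[OF partial_h_smooth], of j i]
    pderiv_mi_partial[of "add_unit_mi (\<lambda>_. 0) j" h i] h_smooth' by simp

lemma partial2_measurable [measurable]: "partial j (partial i h) \<in> borel_measurable borel"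
  unfolding partial2_eq using p by (intro pderiv_h_measurable) simp

lemma partial2_bound:
  obtains K where "K \<ge> 0" "\<And>i j x. \<bar>partial j (partial i h) x\<bar> \<le> K"
proof
  let ?s = "\<lambda>i j. sup_norm_mi h (add_unit_mi (add_unit_mi (\<lambda>_. 0) j) i)"
  have b: "\<bar>partial j (partial i h) x\<bar> \<le> ?s i j" for i j x
    unfolding partial2_eq by (rule pderiv_h_bound) auto
  then have s0: "?s i j \<ge> 0" for i j using abs_ge_zero order_trans by blast
  show "0 \<le> (\<Sum>i\<in>UNIV. \<Sum>j\<in>UNIV. ?s i j)" by (intro sum_nonneg s0)
  fix i j x
  have "\<bar>partial j (partial i h) x\<bar> \<le> ?s i j" by (rule b)
  also have "\<dots> \<le> (\<Sum>j\<in>UNIV. ?s i j)" by (intro member_le_sum s0) auto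
  also have "\<dots> \<le> (\<Sum>i\<in>UNIV. \<Sum>j\<in>UNIV. ?s i j)"
    by (rule member_le_sum[where f = "\<lambda>i. \<Sum>j\<in>UNIV. ?s i j"]) (auto intro: sum_nonneg s0)
  finally show "\<bar>partial j (partial i h) x\<bar> \<le> (\<Sum>i\<in>UNIV. \<Sum>j\<in>UNIV. ?s i j)" .
qed

lemma gradient_growth:
  obtains A where "A \<ge> 0" "\<And>i y. \<bar>partial i h y\<bar> \<le> A * (1 + norm y)"
proof -
  obtain K where "K \<ge> 0" and K: "\<And>i j x. \<bar>partial j (partial i h) x\<bar> \<le> K"
    by (rule partial2_bound) (rule that)
  show ?thesis
    by (rule gradient_linear_growth[OF partial_h_differentiable K]) (rule that)
qed

lemma Z_norm: "integrable N (\<lambda>z. norm (Z z))"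
  by (intro integrable_norm_of_square Zg.prob_space_axioms Zg.integrable_norm_square) simp

lemma gradient_integrable: "integrable N (\<lambda>z. partial i h (y + c *\<^sub>R Z z))"
proof -
  obtain A where A: "A \<ge> 0" "\<And>i y. \<bar>partial i h y\<bar> \<le> A * (1 + norm y)" using gradient_growth by blast
  show ?thesis
  proof (rule Bochner_Integration.integrable_bound)
    show "integrable N (\<lambda>z. A * (1 + (norm y + \<bar>c\<bar> * norm (Z z))))" using Z_norm by simp
    show "AE z in N. norm (partial i h (y + c *\<^sub>R Z z)) \<le> norm (A * (1 + (norm y + \<bar>c\<bar> * norm (Z z))))"
    proof (rule AE_I2)
      fix z
      have "A * (1 + norm (y + c *\<^sub>R Z z)) \<le> A * (1 + (norm y + \<bar>c\<bar> * norm (Z z)))"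
        using norm_triangle_ineq[of y "c *\<^sub>R Z z"] A(1) by (intro mult_left_mono) auto
      then show "norm (partial i h (y + c *\<^sub>R Z z)) \<le> norm (A * (1 + (norm y + \<bar>c\<bar> * norm (Z z))))"
        using A(2)[of i "y + c *\<^sub>R Z z"] by simp
    qed
  qed measurable
qed

lemma pderiv_integrable:
  assumes "2 \<le> mi_abs \<beta>" "mi_abs \<beta> \<le> p + 1"
  shows "integrable N (\<lambda>z. pderiv_mi \<beta> h (y + c *\<^sub>R Z z))"
proof -
  have [measurable]: "pderiv_mi \<beta> h \<in> borel_measurable borel" using assms by (intro pderiv_h_measurable)
  show ?thesis
    by (rule Zg.integrable_const_bound[of _ "sup_norm_mi h \<beta>"]) (use assms pderiv_h_bound in auto)
qed

section \<open>Averaged derivatives and the Stein increment\<close>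

lemma g_measurable [measurable]: "g s c i \<in> borel_measurable borel"
  unfolding g_def by measurable

lemma V_measurable:
  assumes "mi_abs \<beta> \<le> p + 1"
  shows "V s c \<beta> \<in> borel_measurable borel"
proof -
  have [measurable]: "pderiv_mi \<beta> h \<in> borel_measurable borel" using assms by (intro pderiv_h_measurable)
  show ?thesis unfolding V_def by measurable
qed

lemma V_bound:
  assumes "2 \<le> mi_abs \<beta>" "mi_abs \<beta> \<le> p + 1"
  shows "\<bar>V s c \<beta> w\<bar> \<le> sup_norm_mi h \<beta>"
proof -
  have "\<bar>V s c \<beta> w\<bar> \<le> (\<integral>z. \<bar>pderiv_mi \<beta> h (s *\<^sub>R w + c *\<^sub>R Z z)\<bar> \<partial>N)"
    unfolding V_def by (rule integral_abs_bound)
  also have "\<dots> \<le> (\<integral>z. sup_norm_mi h \<beta> \<partial>N)"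
    using assms by (intro integral_mono integrable_abs pderiv_integrable pderiv_h_bound) auto
  finally show ?thesis by (simp add: Zg.prob_space)
qed

lemma V_integrable:
  assumes "2 \<le> mi_abs \<beta>" "mi_abs \<beta> \<le> p + 1"
  shows "integrable M (\<lambda>x. V s c \<beta> (W x))"
proof -
  have [measurable]: "V s c \<beta> \<in> borel_measurable borel" using assms by (intro V_measurable)
  show ?thesis
    by (rule integrable_const_bound[of _ "sup_norm_mi h \<beta>"]) (use assms V_bound in auto)
qed

text \<open>Taylor's formula is applied for each fixed value of the Gaussian variable, before
  averaging. The intermediate point depends on that value in an uncontrolled way, so the remainder
  is kept as the integrable difference \<open>T\<close>, and derivatives of order
  \<open>p + 2\<close> enter only through a bound uniform in \<open>z\<close>.\<close>

lemma taylor_remainder: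
  assumes s: "s \<ge> 0"
  shows "\<bar>g s c i w' - g s c i w
      - (\<Sum>\<alpha>\<in>{\<alpha>. 1 \<le> mi_abs \<alpha> \<and> mi_abs \<alpha> \<le> p}. s ^ mi_abs \<alpha> / mi_fact \<alpha> * (mi_pow (w' - w) \<alpha> * V s c (add_unit_mi \<alpha> i) w))\<bar>
    \<le> (\<Sum>\<alpha>\<in>{\<alpha>. mi_abs \<alpha> = p + 1}. s ^ (p + 1) * nrm i \<alpha> / mi_fact \<alpha> * \<bar>mi_pow (w' - w) \<alpha>\<bar>)"
    (is "\<bar>g s c i w' - g s c i w - (\<Sum>\<alpha>\<in>?A. ?a \<alpha> * (?m \<alpha> * V s c (add_unit_mi \<alpha> i) w))\<bar> \<le> ?R")
proof -
  define T where "T z = partial i h (s *\<^sub>R w' + c *\<^sub>R Z z) - partial i h (s *\<^sub>R w + c *\<^sub>R Z z)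
      - (\<Sum>\<alpha>\<in>?A. ?a \<alpha> * (?m \<alpha> * pderiv_mi (add_unit_mi \<alpha> i) h (s *\<^sub>R w + c *\<^sub>R Z z)))" for z
  have i1: "integrable N (\<lambda>z. \<Sum>\<alpha>\<in>?A. ?a \<alpha> * (?m \<alpha> * pderiv_mi (add_unit_mi \<alpha> i) h (s *\<^sub>R w + c *\<^sub>R Z z)))"
    by (intro Bochner_Integration.integrable_sum integrable_mult_right pderiv_integrable) auto
  have Ti: "integrable N T" unfolding T_def
    by (intro Bochner_Integration.integrable_diff gradient_integrable i1)
  have "(\<integral>z. T z \<partial>N) = g s c i w' - g s c i w
     - (\<integral>z. (\<Sum>\<alpha>\<in>?A. ?a \<alpha> * (?m \<alpha> * pderiv_mi (add_unit_mi \<alpha> i) h (s *\<^sub>R w + c *\<^sub>R Z z))) \<partial>N)"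
    unfolding T_def g_def using i1 gradient_integrable by simp
  also have "(\<integral>z. (\<Sum>\<alpha>\<in>?A. ?a \<alpha> * (?m \<alpha> * pderiv_mi (add_unit_mi \<alpha> i) h (s *\<^sub>R w + c *\<^sub>R Z z))) \<partial>N)
     = (\<Sum>\<alpha>\<in>?A. \<integral>z. ?a \<alpha> * (?m \<alpha> * pderiv_mi (add_unit_mi \<alpha> i) h (s *\<^sub>R w + c *\<^sub>R Z z)) \<partial>N)"
    by (intro Bochner_Integration.integral_sum integrable_mult_right pderiv_integrable) auto
  also have "\<dots> = (\<Sum>\<alpha>\<in>?A. ?a \<alpha> * (?m \<alpha> * V s c (add_unit_mi \<alpha> i) w))"
    unfolding V_def by (simp only: integral_mult_right_zero)
  finally have T: "(\<integral>z. T z \<partial>N) = g s c i w' - g s c i w - (\<Sum>\<alpha>\<in>?A. ?a \<alpha> * (?m \<alpha> * V s c (add_unit_mi \<alpha> i) w))" .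
  have Tb: "\<bar>T z\<bar> \<le> ?R" for z
  proof -
    let ?y = "s *\<^sub>R w + c *\<^sub>R Z z" and ?v = "s *\<^sub>R (w' - w)"
    obtain \<xi> where "partial i h (?y + ?v) = partial i h ?y
       + (\<Sum>\<alpha>\<in>?A. mi_pow ?v \<alpha> * pderiv_mi \<alpha> (partial i h) ?y / mi_fact \<alpha>)
       + (\<Sum>\<alpha>\<in>{\<alpha>. mi_abs \<alpha> = Suc p}. mi_pow ?v \<alpha> * pderiv_mi \<alpha> (partial i h) \<xi> / mi_fact \<alpha>)"
      using mi_taylor[of p "partial i h" ?y ?v] partial_h_smooth[of i] by auto
    moreover have "?y + ?v = s *\<^sub>R w' + c *\<^sub>R Z z" by (simp add: algebra_simps)
    moreover have "(\<Sum>\<alpha>\<in>?A. mi_pow ?v \<alpha> * pderiv_mi \<alpha> (partial i h) ?y / mi_fact \<alpha>)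
       = (\<Sum>\<alpha>\<in>?A. ?a \<alpha> * (?m \<alpha> * pderiv_mi (add_unit_mi \<alpha> i) h ?y))"
      using h_smooth' by (intro sum.cong) (auto simp: mi_pow_scaleR pderiv_mi_partial)
    ultimately have "T z = (\<Sum>\<alpha>\<in>{\<alpha>. mi_abs \<alpha> = Suc p}. mi_pow ?v \<alpha> * pderiv_mi \<alpha> (partial i h) \<xi> / mi_fact \<alpha>)"
      by (simp add: T_def)
    also have "\<bar>\<dots>\<bar> \<le> (\<Sum>\<alpha>\<in>{\<alpha>. mi_abs \<alpha> = Suc p}. s ^ (p + 1) * nrm i \<alpha> / mi_fact \<alpha> * \<bar>mi_pow (w' - w) \<alpha>\<bar>)"
    proof (intro order_trans[OF sum_abs] sum_mono)
      fix \<alpha> :: "'d \<Rightarrow> nat" assume "\<alpha> \<in> {\<alpha>. mi_abs \<alpha> = Suc p}"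
      then have \<alpha>: "mi_abs \<alpha> = Suc p" by simp
      have b: "\<bar>pderiv_mi \<alpha> (partial i h) \<xi>\<bar> \<le> nrm i \<alpha>"
        using \<alpha> h_smooth p by (subst pderiv_mi_partial) (auto intro!: pderiv_h_bound)
      have "\<bar>mi_pow ?v \<alpha> * pderiv_mi \<alpha> (partial i h) \<xi> / mi_fact \<alpha>\<bar>
         = (s ^ (p + 1) * \<bar>mi_pow (w' - w) \<alpha>\<bar> / mi_fact \<alpha>) * \<bar>pderiv_mi \<alpha> (partial i h) \<xi>\<bar>"
        using s \<alpha> less_imp_le[OF mi_fact_pos[of \<alpha>]] by (simp add: mi_pow_scaleR abs_mult abs_divide)
      also have "\<dots> \<le> (s ^ (p + 1) * \<bar>mi_pow (w' - w) \<alpha>\<bar> / mi_fact \<alpha>) * nrm i \<alpha>"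
        using s b less_imp_le[OF mi_fact_pos[of \<alpha>]] by (intro mult_left_mono) auto
      finally show "\<bar>mi_pow ?v \<alpha> * pderiv_mi \<alpha> (partial i h) \<xi> / mi_fact \<alpha>\<bar>
         \<le> s ^ (p + 1) * nrm i \<alpha> / mi_fact \<alpha> * \<bar>mi_pow (w' - w) \<alpha>\<bar>"
        by (simp add: mult_ac)
    qed
    finally show ?thesis by simp
  qed
  have "\<bar>\<integral>z. T z \<partial>N\<bar> \<le> (\<integral>z. \<bar>T z\<bar> \<partial>N)" by (rule integral_abs_bound)
  also have "\<dots> \<le> (\<integral>z. ?R \<partial>N)" using Ti Tb by (intro integral_mono) auto
  finally show ?thesis unfolding T by (simp add: Zg.prob_space)
qed

text \<open>Integrability of the increment is derived: it is a Taylor polynomial with bounded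
  coefficients \<open>V\<close> and integrable factors \<open>GD\<close>, plus a remainder dominated
  by the moments of order \<open>p + 1\<close>. This admits \<open>g\<close> as a test function for
  the coupling.\<close>

lemma stein_increment_integrable:
  fixes s c :: real and i :: 'd
  assumes s: "s \<ge> 0"
  defines "A \<equiv> {\<alpha> :: 'd \<Rightarrow> nat. 1 \<le> mi_abs \<alpha> \<and> mi_abs \<alpha> \<le> p}"
  defines "Rm \<equiv> \<lambda>x. G x $ i * (g s c i (W' x) - g s c i (W x))
       - (\<Sum>\<alpha>\<in>A. s ^ mi_abs \<alpha> / mi_fact \<alpha> * (GD i \<alpha> x * V s c (add_unit_mi \<alpha> i) (W x)))"
  shows "integrable M (\<lambda>x. G x $ i * (g s c i (W' x) - g s c i (W x)))" (is ?th1)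
    and "integrable M Rm" (is ?th2)
    and "\<bar>\<integral>x. Rm x \<partial>M\<bar> \<le> (\<Sum>\<alpha>\<in>{\<alpha>. mi_abs \<alpha> = p + 1}. s ^ (p + 1) * nrm i \<alpha> / mi_fact \<alpha> * (\<integral>x. \<bar>GD i \<alpha> x\<bar> \<partial>M))" (is ?th3)
    and "\<And>\<alpha>. \<alpha> \<in> A \<Longrightarrow> integrable M (\<lambda>x. GD i \<alpha> x * V s c (add_unit_mi \<alpha> i) (W x))"
proof -
  let ?Q = "\<lambda>x. \<Sum>\<alpha>\<in>{\<alpha>. mi_abs \<alpha> = p + 1}. s ^ (p + 1) * nrm i \<alpha> / mi_fact \<alpha> * \<bar>GD i \<alpha> x\<bar>"
  show GDV: "integrable M (\<lambda>x. GD i \<alpha> x * V s c (add_unit_mi \<alpha> i) (W x))" if "\<alpha> \<in> A" for \<alpha>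
  proof (rule integrable_mult_bounded)
    have [measurable]: "V s c (add_unit_mi \<alpha> i) \<in> borel_measurable borel"
      using that by (intro V_measurable) (auto simp: A_def)
    show "(\<lambda>x. V s c (add_unit_mi \<alpha> i) (W x)) \<in> borel_measurable M" by measurable
    show "\<bar>V s c (add_unit_mi \<alpha> i) (W x)\<bar> \<le> nrm i \<alpha>" for x
      using that by (intro V_bound) (auto simp: A_def)
    show "integrable M (GD i \<alpha>)" using that by (intro GD_integrable) (auto simp: A_def)
  qed
  have Pi: "integrable M (\<lambda>x. \<Sum>\<alpha>\<in>A. s ^ mi_abs \<alpha> / mi_fact \<alpha> * (GD i \<alpha> x * V s c (add_unit_mi \<alpha> i) (W x)))"
    by (intro Bochner_Integration.integrable_sum integrable_mult_right GDV)
  have Qi: "integrable M ?Q"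
    by (intro Bochner_Integration.integrable_sum integrable_mult_right integrable_abs GD_integrable) auto
  have bound: "\<bar>Rm x\<bar> \<le> ?Q x" for x
  proof -
    have eq: "Rm x = G x $ i * (g s c i (W' x) - g s c i (W x)
      - (\<Sum>\<alpha>\<in>A. s ^ mi_abs \<alpha> / mi_fact \<alpha> * (mi_pow (W' x - W x) \<alpha> * V s c (add_unit_mi \<alpha> i) (W x))))"
      unfolding Rm_def by (simp add: right_diff_distrib sum_distrib_left mult_ac)
    have "\<bar>Rm x\<bar> \<le> \<bar>G x $ i\<bar> * (\<Sum>\<alpha>\<in>{\<alpha>. mi_abs \<alpha> = p + 1}. s ^ (p + 1) * nrm i \<alpha> / mi_fact \<alpha> * \<bar>mi_pow (W' x - W x) \<alpha>\<bar>)"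
      unfolding eq abs_mult A_def by (intro mult_left_mono taylor_remainder s) simp
    also have "\<dots> = ?Q x" by (simp add: sum_distrib_left abs_mult mult_ac)
    finally show ?thesis .
  qed
  have Rmm: "Rm \<in> borel_measurable M"
  proof -
    have "(\<lambda>x. G x $ i * (g s c i (W' x) - g s c i (W x))) \<in> borel_measurable M" by measurable
    then show ?thesis unfolding Rm_def using Pi by (intro borel_measurable_diff) auto
  qed
  show Rmi: ?th2
    by (rule Bochner_Integration.integrable_bound[OF Qi Rmm])      (rule AE_I2, unfold real_norm_def, rule order_trans[OF bound abs_ge_self])
  have "(\<lambda>x. G x $ i * (g s c i (W' x) - g s c i (W x)))
     = (\<lambda>x. Rm x + (\<Sum>\<alpha>\<in>A. s ^ mi_abs \<alpha> / mi_fact \<alpha> * (GD i \<alpha> x * V s c (add_unit_mi \<alpha> i) (W x))))"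
    by (simp add: Rm_def)
  then show ?th1 using Bochner_Integration.integrable_add[OF Rmi Pi] by simp
  have "\<bar>\<integral>x. Rm x \<partial>M\<bar> \<le> (\<integral>x. \<bar>Rm x\<bar> \<partial>M)" by (rule integral_abs_bound)
  also have "\<dots> \<le> (\<integral>x. ?Q x \<partial>M)" using Rmi Qi bound by (intro integral_mono) auto
  also have "\<dots> = (\<Sum>\<alpha>\<in>{\<alpha>. mi_abs \<alpha> = p + 1}. \<integral>x. s ^ (p + 1) * nrm i \<alpha> / mi_fact \<alpha> * \<bar>GD i \<alpha> x\<bar> \<partial>M)"
    by (intro Bochner_Integration.integral_sum integrable_mult_right integrable_abs GD_integrable) auto
  finally show ?th3 by (simp only: integral_mult_right_zero)
qed

text \<open>The contribution of coordinate \<open>i\<close> before integration over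
  \<open>t\<close>: \<open>s ^ mi_abs \<alpha>\<close> stands where the factor
  \<open>1 / (mi_abs \<alpha> + 1)\<close> will appear.\<close>

definition bnd :: "'d \<Rightarrow> real \<Rightarrow> real" where
  "bnd i s =
     (\<Sum>\<alpha>\<in>{\<alpha>. 1 \<le> mi_abs \<alpha> \<and> mi_abs \<alpha> \<le> p}. s ^ mi_abs \<alpha> * nrm i \<alpha> / mi_fact \<alpha>
         * sqrt (Var M (cond_exp_given M W (GD i \<alpha>))))
   + (\<Sum>\<alpha>\<in>{\<alpha>. 2 \<le> mi_abs \<alpha> \<and> mi_abs \<alpha> \<le> p}. s ^ mi_abs \<alpha> * nrm i \<alpha> / mi_fact \<alpha>
         * \<bar>\<integral>x. GD i \<alpha> x \<partial>M\<bar>)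
   + (\<Sum>\<alpha>\<in>{\<alpha>. mi_abs \<alpha> = p + 1}. s ^ (p + 1) * nrm i \<alpha> / mi_fact \<alpha>
         * (\<integral>x. \<bar>GD i \<alpha> x\<bar> \<partial>M))"

lemma mi_pow_unit: "mi_pow v (add_unit_mi (\<lambda>_. 0) j) = v $ j"
  by (simp add: mi_pow_add_unit) (simp add: mi_pow_def)

lemma GD_unit: "(\<integral>x. GD i (add_unit_mi (\<lambda>_. 0) j) x \<partial>M) = S $ i $ j"
  using cov_matrix_stein[of i j] GD_integrable[of "add_unit_mi (\<lambda>_. 0) j" i] by (simp add: mi_pow_unit)

text \<open>The terms with \<open>|\<alpha>| = 1\<close> cancel the Gaussian covariance contribution up to centring,
  as \<open>E (G_i D_j) = S_ij\<close>.\<close>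

lemma stein_increment_bound:
  assumes s: "s \<ge> 0"
  shows "\<bar>(\<integral>x. G x $ i * (g s c i (W' x) - g s c i (W x)) \<partial>M)
      - s * (\<Sum>j\<in>UNIV. S $ i $ j * (\<integral>x. V s c (add_unit_mi (add_unit_mi (\<lambda>_. 0) j) i) (W x) \<partial>M))\<bar> \<le> bnd i s"
proof -
  define A where "A = {\<alpha> :: 'd \<Rightarrow> nat. 1 \<le> mi_abs \<alpha> \<and> mi_abs \<alpha> \<le> p}"
  define A2 where "A2 = {\<alpha> :: 'd \<Rightarrow> nat. 2 \<le> mi_abs \<alpha> \<and> mi_abs \<alpha> \<le> p}"
  define A1 where "A1 = {\<alpha> :: 'd \<Rightarrow> nat. mi_abs \<alpha> = Suc 0}"
  have A: "A = A1 \<union> A2" "A1 \<inter> A2 = {}" "finite A1" "finite A2"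
    using p unfolding A_def A1_def A2_def by auto
  define a where "a \<alpha> = s ^ mi_abs \<alpha> / mi_fact \<alpha>" for \<alpha> :: "'d \<Rightarrow> nat"
  have a0: "a \<alpha> \<ge> 0" for \<alpha> using s less_imp_le[OF mi_fact_pos[of \<alpha>]] by (simp add: a_def)
  \<comment> \<open>With means \<open>m\<close>, \<open>v\<close> and mixed moment \<open>e\<close>,
    the difference \<open>e \<alpha> - m \<alpha> * v \<alpha>\<close> is a covariance, to be
    bounded through the conditional expectation.\<close>
  define m where "m \<alpha> = (\<integral>x. GD i \<alpha> x \<partial>M)" for \<alpha>
  define v where "v \<alpha> = (\<integral>x. V s c (add_unit_mi \<alpha> i) (W x) \<partial>M)" for \<alpha>
  define e where "e \<alpha> = (\<integral>x. GD i \<alpha> x * V s c (add_unit_mi \<alpha> i) (W x) \<partial>M)" for \<alpha>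
  define Rm where "Rm x = G x $ i * (g s c i (W' x) - g s c i (W x))
       - (\<Sum>\<alpha>\<in>A. a \<alpha> * (GD i \<alpha> x * V s c (add_unit_mi \<alpha> i) (W x)))" for x
  note inc = stein_increment_integrable[where i = i and c = c, OF s, folded A_def a_def, folded Rm_def]
  have "(\<integral>x. G x $ i * (g s c i (W' x) - g s c i (W x)) \<partial>M)
      = (\<integral>x. Rm x + (\<Sum>\<alpha>\<in>A. a \<alpha> * (GD i \<alpha> x * V s c (add_unit_mi \<alpha> i) (W x))) \<partial>M)"
    by (simp add: Rm_def)
  also have "\<dots> = (\<integral>x. Rm x \<partial>M) + (\<integral>x. (\<Sum>\<alpha>\<in>A. a \<alpha> * (GD i \<alpha> x * V s c (add_unit_mi \<alpha> i) (W x))) \<partial>M)"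
    by (intro Bochner_Integration.integral_add inc(2) Bochner_Integration.integrable_sum integrable_mult_right inc(4))
  also have "(\<integral>x. (\<Sum>\<alpha>\<in>A. a \<alpha> * (GD i \<alpha> x * V s c (add_unit_mi \<alpha> i) (W x))) \<partial>M)
     = (\<Sum>\<alpha>\<in>A. \<integral>x. a \<alpha> * (GD i \<alpha> x * V s c (add_unit_mi \<alpha> i) (W x)) \<partial>M)"
    by (intro Bochner_Integration.integral_sum integrable_mult_right inc(4))
  also have "\<dots> = (\<Sum>\<alpha>\<in>A. a \<alpha> * e \<alpha>)" by (simp only: integral_mult_right_zero e_def)
  finally have H: "(\<integral>x. G x $ i * (g s c i (W' x) - g s c i (W x)) \<partial>M) = (\<integral>x. Rm x \<partial>M) + (\<Sum>\<alpha>\<in>A. a \<alpha> * e \<alpha>)" .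
  \<comment> \<open>The multi-indices of order 1 are the units, so \<open>sum_mi_Suc\<close> at
    \<open>k = 0\<close> turns this sum into one over \<open>j\<close>, where \<open>m\<close> takes
    the values \<open>S $ i $ j\<close>.\<close>
  have "(\<Sum>\<alpha>\<in>A1. a \<alpha> * (m \<alpha> * v \<alpha>)) = (\<Sum>\<alpha>\<in>A1. s * (m \<alpha> * v \<alpha>) / mi_fact \<alpha>)"
    by (intro sum.cong) (auto simp: A1_def a_def)
  also have "\<dots> = (\<Sum>j\<in>UNIV. s * (m (add_unit_mi (\<lambda>_. 0) j) * v (add_unit_mi (\<lambda>_. 0) j)))"
    using sum_mi_Suc[of "\<lambda>\<alpha>. s * (m \<alpha> * v \<alpha>)" 0] by (simp add: A1_def mi_fact_def)
  also have "\<dots> = s * (\<Sum>j\<in>UNIV. S $ i $ j * v (add_unit_mi (\<lambda>_. 0) j))"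
    by (simp add: m_def GD_unit sum_distrib_left)
  finally have one: "s * (\<Sum>j\<in>UNIV. S $ i $ j * v (add_unit_mi (\<lambda>_. 0) j)) = (\<Sum>\<alpha>\<in>A1. a \<alpha> * (m \<alpha> * v \<alpha>))" ..
  \<comment> \<open>Subtracting the Gaussian term removes the product of means at order 1 only; from
    order 2 on it survives and gives the second sum of the bound.\<close>
  have split: "(\<Sum>\<alpha>\<in>A. a \<alpha> * e \<alpha>) - (\<Sum>\<alpha>\<in>A1. a \<alpha> * (m \<alpha> * v \<alpha>))
     = (\<Sum>\<alpha>\<in>A. a \<alpha> * (e \<alpha> - m \<alpha> * v \<alpha>)) + (\<Sum>\<alpha>\<in>A2. a \<alpha> * (m \<alpha> * v \<alpha>))"
    unfolding A(1) by (simp add: sum.union_disjoint[OF A(3,4,2)] right_diff_distrib sum_subtractf)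
  have t1: "\<bar>\<Sum>\<alpha>\<in>A. a \<alpha> * (e \<alpha> - m \<alpha> * v \<alpha>)\<bar> \<le> (\<Sum>\<alpha>\<in>A. s ^ mi_abs \<alpha> * nrm i \<alpha> / mi_fact \<alpha>
         * sqrt (Var M (cond_exp_given M W (GD i \<alpha>))))"
  proof (intro order_trans[OF sum_abs] sum_mono)
    fix \<alpha> assume "\<alpha> \<in> A"
    then have \<alpha>: "1 \<le> mi_abs \<alpha>" "mi_abs \<alpha> \<le> p" by (auto simp: A_def)
    have "\<bar>e \<alpha> - m \<alpha> * v \<alpha>\<bar> \<le> nrm i \<alpha> * sqrt (Var M (cond_exp_given M W (GD i \<alpha>)))"
      unfolding e_def m_def v_def
      by (rule covariance_le_sqrt_Var_cond_exp)
         (use \<alpha> in \<open>auto intro!: prob_space_axioms V_measurable GD_integrable cond_exp_square V_bound\<close>)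
    from mult_left_mono[OF this a0[of \<alpha>]]
    show "\<bar>a \<alpha> * (e \<alpha> - m \<alpha> * v \<alpha>)\<bar> \<le> s ^ mi_abs \<alpha> * nrm i \<alpha> / mi_fact \<alpha>
         * sqrt (Var M (cond_exp_given M W (GD i \<alpha>)))"
      unfolding abs_mult[of "a \<alpha>"] abs_of_nonneg[OF a0] by (simp add: a_def mult.assoc)
  qed
  have t2: "\<bar>\<Sum>\<alpha>\<in>A2. a \<alpha> * (m \<alpha> * v \<alpha>)\<bar> \<le> (\<Sum>\<alpha>\<in>A2. s ^ mi_abs \<alpha> * nrm i \<alpha> / mi_fact \<alpha> * \<bar>m \<alpha>\<bar>)"
  proof (intro order_trans[OF sum_abs] sum_mono)
    fix \<alpha> assume "\<alpha> \<in> A2"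
    then have \<alpha>: "2 \<le> mi_abs \<alpha>" "mi_abs \<alpha> \<le> p" by (auto simp: A2_def)
    have Vb: "\<bar>V s c (add_unit_mi \<alpha> i) w\<bar> \<le> nrm i \<alpha>" for w using \<alpha> by (intro V_bound) auto
    have Vi: "integrable M (\<lambda>x. V s c (add_unit_mi \<alpha> i) (W x))" using \<alpha> by (intro V_integrable) auto
    have "\<bar>v \<alpha>\<bar> \<le> (\<integral>x. nrm i \<alpha> \<partial>M)" unfolding v_def
      using Vi Vb by (intro order_trans[OF integral_abs_bound] integral_mono) auto
    then have "\<bar>v \<alpha>\<bar> \<le> nrm i \<alpha>" by (simp add: prob_space)
    then have "(a \<alpha> * \<bar>m \<alpha>\<bar>) * \<bar>v \<alpha>\<bar> \<le> (a \<alpha> * \<bar>m \<alpha>\<bar>) * nrm i \<alpha>"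
      using a0[of \<alpha>] by (intro mult_left_mono) auto
    then show "\<bar>a \<alpha> * (m \<alpha> * v \<alpha>)\<bar> \<le> s ^ mi_abs \<alpha> * nrm i \<alpha> / mi_fact \<alpha> * \<bar>m \<alpha>\<bar>"
      unfolding abs_mult abs_of_nonneg[OF a0] by (simp add: a_def mult_ac)
  qed
  have "(\<integral>x. G x $ i * (g s c i (W' x) - g s c i (W x)) \<partial>M) - s * (\<Sum>j\<in>UNIV. S $ i $ j * v (add_unit_mi (\<lambda>_. 0) j))
     = (\<Sum>\<alpha>\<in>A. a \<alpha> * (e \<alpha> - m \<alpha> * v \<alpha>)) + (\<Sum>\<alpha>\<in>A2. a \<alpha> * (m \<alpha> * v \<alpha>)) + (\<integral>x. Rm x \<partial>M)"
    using H one split by simp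
  also have "\<bar>\<dots>\<bar> \<le> bnd i s"
    using t1 t2 inc(3) unfolding bnd_def A_def[symmetric] A2_def[symmetric] m_def[symmetric] by linarith
  finally show ?thesis unfolding v_def .
qed

section \<open>The interpolating function and its derivative\<close>

lemma gradient_product_bound:
  assumes A: "A \<ge> 0" "\<And>i y. \<bar>partial i h y\<bar> \<le> A * (1 + norm y)"
    and c: "\<bar>k\<bar> \<le> norm w + norm z"
  shows "\<bar>k * partial j h (sin t *\<^sub>R w + cos t *\<^sub>R z)\<bar> \<le> 4 * A * (1 + (norm w)\<^sup>2 + (norm z)\<^sup>2)"
proof -
  have "\<bar>partial j h (sin t *\<^sub>R w + cos t *\<^sub>R z)\<bar> \<le> A * (1 + (norm w + norm z))"
    by (rule order_trans[OF A(2)]) (use A(1) norm_sin_cos_le[of t w z] in \<open>auto intro!: mult_left_mono\<close>)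
  then have "\<bar>k * partial j h (sin t *\<^sub>R w + cos t *\<^sub>R z)\<bar> \<le> \<bar>k\<bar> * (A * (1 + (norm w + norm z)))"
    unfolding abs_mult by (rule mult_left_mono) simp
  also have "\<dots> = A * (\<bar>k\<bar> * (1 + (norm w + norm z)))" by (simp add: mult_ac)
  also have "\<dots> \<le> A * (4 * (1 + (norm w)\<^sup>2 + (norm z)\<^sup>2))"
    using A(1) c by (intro mult_left_mono product_quadratic_bound) auto
  finally show ?thesis by (simp add: mult_ac)
qed

lemma gradient_product_integrable:
  assumes k [measurable]: "k \<in> borel_measurable (M \<Otimes>\<^sub>M N)" and kb: "\<And>x z. \<bar>k (x, z)\<bar> \<le> norm (W x) + norm (Z z)"
  shows "integrable (M \<Otimes>\<^sub>M N) (\<lambda>y. k y * partial j h (sin t *\<^sub>R W (fst y) + cos t *\<^sub>R Z (snd y)))"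
proof -
  obtain A where A: "A \<ge> 0" "\<And>i y. \<bar>partial i h y\<bar> \<le> A * (1 + norm y)" using gradient_growth by blast
  show ?thesis
  proof (rule integrable_pair_quadratic[OF prob_space_axioms Zg.prob_space_axioms W_norm_square Zg.integrable_norm_square])
    show "\<bar>k (x, z) * partial j h (sin t *\<^sub>R W (fst (x, z)) + cos t *\<^sub>R Z (snd (x, z)))\<bar>
       \<le> 4 * A * (1 + (norm (W x))\<^sup>2 + (norm (Z z))\<^sup>2)" for x z
      using gradient_product_bound[OF A kb] by simp
  qed measurable
qed

text \<open>The product space is what makes the two vectors, given on different spaces,
  independent.\<close>

definition \<phi> :: "real \<Rightarrow> real" where
  "\<phi> t = (\<integral>y. h (sin t *\<^sub>R W (fst y) + cos t *\<^sub>R Z (snd y)) \<partial>(M \<Otimes>\<^sub>M N))"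

lemma h_pair_integrable: "integrable (M \<Otimes>\<^sub>M N) (\<lambda>y. h (sin t *\<^sub>R W (fst y) + cos t *\<^sub>R Z (snd y)))"
proof -
  obtain A where A: "A \<ge> 0" "\<And>i y. \<bar>partial i h y\<bar> \<le> A * (1 + norm y)" using gradient_growth by blast
  obtain B where B: "B \<ge> 0" "\<And>y. \<bar>h y\<bar> \<le> B * (1 + (norm y)\<^sup>2)"
    by (rule quadratic_growth[OF h_differentiable A]) (rule that)
  show ?thesis
  proof (rule integrable_pair_quadratic[OF prob_space_axioms Zg.prob_space_axioms W_norm_square Zg.integrable_norm_square])
    fix x z
    have "(norm (sin t *\<^sub>R W x + cos t *\<^sub>R Z z))\<^sup>2 \<le> (norm (W x) + norm (Z z))\<^sup>2"
      by (intro power_mono norm_sin_cos_le) simp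
    also have "\<dots> \<le> 2 * (norm (W x))\<^sup>2 + 2 * (norm (Z z))\<^sup>2"
      using zero_le_power2[of "norm (W x) - norm (Z z)"] by (simp add: power2_eq_square algebra_simps)
    finally have "1 + (norm (sin t *\<^sub>R W x + cos t *\<^sub>R Z z))\<^sup>2 \<le> 2 * (1 + (norm (W x))\<^sup>2 + (norm (Z z))\<^sup>2)" by simp
    from order_trans[OF B(2) mult_left_mono[OF this B(1)]]
    show "\<bar>h (sin t *\<^sub>R W (fst (x, z)) + cos t *\<^sub>R Z (snd (x, z)))\<bar> \<le> (2 * B) * (1 + (norm (W x))\<^sup>2 + (norm (Z z))\<^sup>2)"
      by (simp add: mult_ac)
  qed measurable
qed

lemma \<phi>_ends: "\<phi> (pi / 2) = (\<integral>x. h (W x) \<partial>M)" "\<phi> 0 = (\<integral>z. h (Z z) \<partial>N)"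
  using P.integral_fst'[OF h_pair_integrable, of "pi / 2"] P.integral_fst'[OF h_pair_integrable, of 0]
  by (simp_all add: \<phi>_def prob_space Zg.prob_space)

lemma W_gradient_integrable:
  "integrable (M \<Otimes>\<^sub>M N) (\<lambda>y. W (fst y) $ i * partial j h (sin t *\<^sub>R W (fst y) + cos t *\<^sub>R Z (snd y)))"
proof (rule gradient_product_integrable)
  show "\<bar>W (fst (x, z)) $ i\<bar> \<le> norm (W x) + norm (Z z)" for x z
    using component_le_norm_cart[of "W x" i] by (simp add: add_increasing2)
qed measurable

lemma Z_gradient_integrable:
  "integrable (M \<Otimes>\<^sub>M N) (\<lambda>y. Z (snd y) $ i * partial j h (sin t *\<^sub>R W (fst y) + cos t *\<^sub>R Z (snd y)))"
proof (rule gradient_product_integrable)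
  show "\<bar>Z (snd (x, z)) $ i\<bar> \<le> norm (W x) + norm (Z z)" for x z
    using component_le_norm_cart[of "Z z" i] by (simp add: add_increasing)
qed measurable

text \<open>By Fubini, averaging over \<open>Z\<close> first leaves the expectation of
  \<open>W x $ i\<close> times \<open>g\<close>, to which the Stein identity applies. The sign of
  \<open>sin t\<close> enters through the Taylor bound that makes the increment integrable.\<close>

lemma W_gradient_integral:
  assumes "sin t \<ge> 0"
  shows "(\<Sum>i\<in>UNIV. \<integral>y. W (fst y) $ i * partial i h (sin t *\<^sub>R W (fst y) + cos t *\<^sub>R Z (snd y)) \<partial>(M \<Otimes>\<^sub>M N))
    = (\<Sum>i\<in>UNIV. \<integral>x. G x $ i * (g (sin t) (cos t) i (W' x) - g (sin t) (cos t) i (W x)) \<partial>M)"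
proof -
  have eq: "(\<integral>z. W x $ i * partial i h (sin t *\<^sub>R W x + cos t *\<^sub>R Z z) \<partial>N) = W x $ i * g (sin t) (cos t) i (W x)" for x i
    by (simp add: g_def)
  have "integrable M (\<lambda>x. W x $ i * g (sin t) (cos t) i (W x))" for i
    using P.integrable_fst'[OF W_gradient_integrable[of i i t]] by (simp only: eq fst_conv snd_conv)
  then have "(\<Sum>i\<in>UNIV. \<integral>x. G x $ i * (g (sin t) (cos t) i (W' x) - g (sin t) (cos t) i (W x)) \<partial>M)
     = (\<Sum>i\<in>UNIV. \<integral>x. W x $ i * g (sin t) (cos t) i (W x) \<partial>M)"
    by (intro stein_identity stein_increment_integrable(1)[OF assms] g_measurable)
  also have "\<dots> = (\<Sum>i\<in>UNIV. \<integral>y. W (fst y) $ i * partial i h (sin t *\<^sub>R W (fst y) + cos t *\<^sub>R Z (snd y)) \<partial>(M \<Otimes>\<^sub>M N))"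
  proof (rule sum.cong[OF refl])
    show "(\<integral>x. W x $ i * g (sin t) (cos t) i (W x) \<partial>M)
        = (\<integral>y. W (fst y) $ i * partial i h (sin t *\<^sub>R W (fst y) + cos t *\<^sub>R Z (snd y)) \<partial>(M \<Otimes>\<^sub>M N))" for i
      using P.integral_fst'[OF W_gradient_integrable[of i i t]] by (simp only: eq fst_conv snd_conv)
  qed
  finally show ?thesis ..
qed

text \<open>Integration by parts in the Gaussian variable with \<open>w\<close> frozen; the factor
  \<open>c\<close> is the chain rule for \<open>z \<mapsto> w + c *\<^sub>R z\<close>.\<close>

lemma gaussian_gradient:
  "(\<integral>z. Z z $ i * partial i h (w + c *\<^sub>R Z z) \<partial>N)
    = c * (\<Sum>j\<in>UNIV. S $ i $ j * (\<integral>z. partial j (partial i h) (w + c *\<^sub>R Z z) \<partial>N))"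
proof -
  obtain K where K: "K \<ge> 0" "\<And>i j x. \<bar>partial j (partial i h) x\<bar> \<le> K" by (rule partial2_bound) (rule that)
  let ?f = "\<lambda>z. partial i h (w + c *\<^sub>R z)"
  have d: "partial j ?f z = c * partial j (partial i h) (w + c *\<^sub>R z)" for j z
    by (rule differentiable_affine(2)[OF partial_h_differentiable])
  have "(\<integral>z. Z z $ i * ?f (Z z) \<partial>N) = (\<Sum>j\<in>UNIV. S $ i $ j * (\<integral>z. partial j ?f (Z z) \<partial>N))"
  proof (rule Zg.integration_by_parts)
    show "?f differentiable (at x)" for x
      by (rule differentiable_affine(1)[OF partial_h_differentiable])
    show "\<bar>partial j ?f x\<bar> \<le> \<bar>c\<bar> * K" for j x
      unfolding d abs_mult using K(2) by (rule mult_left_mono) simp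
    have "(\<lambda>z. c * partial j (partial i h) (w + c *\<^sub>R z)) \<in> borel_measurable borel" for j by measurable
    then show "partial j ?f \<in> borel_measurable borel" for j unfolding d[abs_def] by simp
  qed
  then show ?thesis by (simp add: d sum_distrib_left mult_ac)
qed

lemma Z_gradient_integral:
  "(\<integral>y. Z (snd y) $ i * partial i h (sin t *\<^sub>R W (fst y) + cos t *\<^sub>R Z (snd y)) \<partial>(M \<Otimes>\<^sub>M N))
    = cos t * (\<Sum>j\<in>UNIV. S $ i $ j * (\<integral>x. V (sin t) (cos t) (add_unit_mi (add_unit_mi (\<lambda>_. 0) j) i) (W x) \<partial>M))"
proof -
  let ?V = "\<lambda>j. V (sin t) (cos t) (add_unit_mi (add_unit_mi (\<lambda>_. 0) j) i)"
  have eq: "(\<integral>z. Z z $ i * partial i h (sin t *\<^sub>R W x + cos t *\<^sub>R Z z) \<partial>N)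
      = cos t * (\<Sum>j\<in>UNIV. S $ i $ j * ?V j (W x))" for x
    unfolding gaussian_gradient V_def partial2_eq ..
  have Vi: "integrable M (\<lambda>x. ?V j (W x))" for j using p by (intro V_integrable) auto
  have "(\<integral>y. Z (snd y) $ i * partial i h (sin t *\<^sub>R W (fst y) + cos t *\<^sub>R Z (snd y)) \<partial>(M \<Otimes>\<^sub>M N))
      = (\<integral>x. cos t * (\<Sum>j\<in>UNIV. S $ i $ j * ?V j (W x)) \<partial>M)"
    using P.integral_fst'[OF Z_gradient_integrable[of i i t]] by (simp add: eq)
  also have "\<dots> = cos t * (\<Sum>j\<in>UNIV. S $ i $ j * (\<integral>x. ?V j (W x) \<partial>M))"
    using Vi by simp
  finally show ?thesis .
qed

text \<open>The chain rule gives \<open>cos t\<close> times the \<open>W\<close> part minus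
  \<open>sin t\<close> times the \<open>Z\<close> part. Integration by parts supplies a
  \<open>cos t\<close> in the latter, so \<open>cos t\<close> factors out of both, and the bracket
  is the difference bounded in \<open>stein_increment_bound\<close> with
  \<open>s = sin t\<close>.\<close>

lemma \<phi>_deriv:
  assumes "sin t \<ge> 0"
  shows "(\<phi> has_real_derivative (cos t * (\<Sum>i\<in>UNIV.
      (\<integral>x. G x $ i * (g (sin t) (cos t) i (W' x) - g (sin t) (cos t) i (W x)) \<partial>M)
      - sin t * (\<Sum>j\<in>UNIV. S $ i $ j * (\<integral>x. V (sin t) (cos t) (add_unit_mi (add_unit_mi (\<lambda>_. 0) j) i) (W x) \<partial>M))))) (at t)"
proof -
  let ?MN = "M \<Otimes>\<^sub>M N"
  let ?u = "\<lambda>t y. sin t *\<^sub>R W (fst y) + cos t *\<^sub>R Z (snd y)"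
  let ?F' = "\<lambda>t y. \<Sum>j\<in>UNIV. (cos t * W (fst y) $ j - sin t * Z (snd y) $ j) * partial j h (?u t y)"
  obtain A where A: "A \<ge> 0" "\<And>i y. \<bar>partial i h y\<bar> \<le> A * (1 + norm y)" using gradient_growth by blast
  have coef: "\<bar>cos t * w $ j - sin t * z $ j\<bar> \<le> norm w + norm z" for t j and w z :: "real^'d"
  proof -
    have "\<bar>cos t * w $ j\<bar> \<le> 1 * norm w" "\<bar>sin t * z $ j\<bar> \<le> 1 * norm z"
      unfolding abs_mult by (intro mult_mono component_le_norm_cart; simp)+
    then show ?thesis by linarith
  qed
  \<comment> \<open>Independent of \<open>t\<close>, as dominated convergence demands:
    \<open>4 * A\<close> comes from \<open>gradient_product_bound\<close>, and there are
    \<open>CARD('d)\<close> summands.\<close>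
  let ?B = "\<lambda>y. real CARD('d) * (4 * A) * (1 + (norm (W (fst y)))\<^sup>2 + (norm (Z (snd y)))\<^sup>2)"
  have "(\<phi> has_real_derivative (\<integral>y. ?F' t y \<partial>?MN)) (at t)"
    unfolding \<phi>_def
  proof (rule has_real_derivative_integral[where F = "\<lambda>t y. h (?u t y)" and F' = ?F' and B = ?B])
    show "((\<lambda>t. h (?u t y)) has_real_derivative ?F' t y) (at t)" for t y
      by (rule DERIV_circle[OF h_differentiable])
    show "integrable ?MN (\<lambda>y. h (?u t y))" for t by (rule h_pair_integrable)
    show "?F' t \<in> borel_measurable ?MN" for t by measurable
    show "integrable ?MN ?B"
    proof (rule integrable_pair_quadratic[OF prob_space_axioms Zg.prob_space_axioms W_norm_square Zg.integrable_norm_square])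
      show "\<bar>?B (x, z)\<bar> \<le> real CARD('d) * (4 * A) * (1 + (norm (W x))\<^sup>2 + (norm (Z z))\<^sup>2)" for x z
        using A(1) by (subst abs_of_nonneg) auto
    qed measurable
    show "\<bar>?F' t y\<bar> \<le> ?B y" for t y
    proof -
      have "\<bar>?F' t y\<bar> \<le> (\<Sum>j\<in>(UNIV :: 'd set). 4 * A * (1 + (norm (W (fst y)))\<^sup>2 + (norm (Z (snd y)))\<^sup>2))"
        by (intro order_trans[OF sum_abs] sum_mono gradient_product_bound A coef)
      then show ?thesis by simp
    qed
  qed
  also have "(\<integral>y. ?F' t y \<partial>?MN) = (\<integral>y. cos t * (\<Sum>i\<in>UNIV. W (fst y) $ i * partial i h (?u t y))
         - sin t * (\<Sum>i\<in>UNIV. Z (snd y) $ i * partial i h (?u t y)) \<partial>?MN)"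
    by (simp add: left_diff_distrib sum_subtractf sum_distrib_left mult.assoc)
  also have "\<dots> = cos t * (\<Sum>i\<in>UNIV. \<integral>y. W (fst y) $ i * partial i h (?u t y) \<partial>?MN)
      - sin t * (\<Sum>i\<in>UNIV. \<integral>y. Z (snd y) $ i * partial i h (?u t y) \<partial>?MN)"
    using W_gradient_integrable Z_gradient_integrable by simp
  finally show ?thesis
    unfolding W_gradient_integral[OF assms] Z_gradient_integral
    by (simp add: sum_subtractf right_diff_distrib sum_distrib_left mult.left_commute)
qed

text \<open>An explicit primitive of \<open>cos t\<close> times the sum of
  \<open>bnd i (sin t)\<close>: comparing derivatives of \<phi> and \<Phi> then replaces an
  integration over \<open>t\<close>.\<close>

definition \<Phi> :: "real \<Rightarrow> real" where
  "\<Phi> t = (\<Sum>i\<in>UNIV.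
        (\<Sum>\<alpha>\<in>{\<alpha>. 1 \<le> mi_abs \<alpha> \<and> mi_abs \<alpha> \<le> p}.
           nrm i \<alpha> / ((real (mi_abs \<alpha>) + 1) * mi_fact \<alpha>) * sqrt (Var M (cond_exp_given M W (GD i \<alpha>))) * sin t ^ (mi_abs \<alpha> + 1))
      + (\<Sum>\<alpha>\<in>{\<alpha>. 2 \<le> mi_abs \<alpha> \<and> mi_abs \<alpha> \<le> p}.
           nrm i \<alpha> / ((real (mi_abs \<alpha>) + 1) * mi_fact \<alpha>) * \<bar>\<integral>x. GD i \<alpha> x \<partial>M\<bar> * sin t ^ (mi_abs \<alpha> + 1))
      + (\<Sum>\<alpha>\<in>{\<alpha>. mi_abs \<alpha> = p + 1}.
           nrm i \<alpha> / ((real p + 2) * mi_fact \<alpha>) * (\<integral>x. \<bar>GD i \<alpha> x\<bar> \<partial>M) * sin t ^ (p + 2)))"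

lemma \<Phi>_deriv: "(\<Phi> has_real_derivative (cos t * (\<Sum>i\<in>UNIV. bnd i (sin t)))) (at t)"
proof -
  have d: "((\<lambda>t. C / ((real n + 1) * F) * D * sin t ^ (n + 1)) has_real_derivative cos t * (sin t ^ n * C / F * D)) (at t)"
    for C F D :: real and n
  proof -
    have "((\<lambda>t. sin t ^ (n + 1)) has_real_derivative (real n + 1) * (cos t * sin t ^ n)) (at t)"
      by (rule DERIV_cong[OF DERIV_power[OF DERIV_sin]]) simp
    from DERIV_cmult[OF this, of "C / ((real n + 1) * F) * D"]
    moreover have "C / ((real n + 1) * F) * D * ((real n + 1) * (cos t * sin t ^ n)) = cos t * (sin t ^ n * C / F * D)"
    proof -
      have "C / ((real n + 1) * F) = C / F / (real n + 1)" by (simp add: mult.commute)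
      moreover have "real n + 1 \<noteq> 0" by simp
      then have "x / (real n + 1) * D * ((real n + 1) * y) = x * D * y" for x y by simp
      ultimately show ?thesis by (simp only:) (simp add: mult_ac)
    qed
    ultimately show ?thesis by (rule DERIV_cong)
  qed
  \<comment> \<open>The case \<open>n = p + 1\<close>, where \<open>n + 1\<close> becomes
    \<open>p + 2\<close>.\<close>
  have d': "((\<lambda>t. C / ((real p + 2) * F) * D * sin t ^ (p + 2)) has_real_derivative cos t * (sin t ^ (p + 1) * C / F * D)) (at t)"
    for C F D :: real
    using d[of C "p + 1" F D] by (simp add: add.commute)
  show ?thesis
    unfolding \<Phi>_def bnd_def sum_distrib_left distrib_left
    by (intro DERIV_sum DERIV_add d d')
qed

theorem interpolation_bound: "\<bar>(\<integral>x. h (W x) \<partial>M) - (\<integral>z. h (Z z) \<partial>N)\<bar> \<le> \<Phi> (pi / 2)"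
proof -
  let ?D = "\<lambda>t. cos t * (\<Sum>i\<in>UNIV.
      (\<integral>x. G x $ i * (g (sin t) (cos t) i (W' x) - g (sin t) (cos t) i (W x)) \<partial>M)
      - sin t * (\<Sum>j\<in>UNIV. S $ i $ j * (\<integral>x. V (sin t) (cos t) (add_unit_mi (add_unit_mi (\<lambda>_. 0) j) i) (W x) \<partial>M)))"
  have sin: "sin t \<ge> 0" if "0 \<le> t" "t \<le> pi / 2" for t using that by (intro sin_ge_zero) auto
  \<comment> \<open>The mean value inequality with a variable bound; the derivatives are compared on
    the open quarter circle, where sine and cosine are nonnegative.\<close>
  have "norm (\<phi> (pi / 2) - \<phi> 0) \<le> \<Phi> (pi / 2) - \<Phi> 0"
  proof (rule differentiable_bound_general)
    show "continuous_on {0..pi / 2} \<phi>"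
      by (rule DERIV_continuous_on[of _ _ ?D]) (auto intro!: has_field_derivative_at_within[OF \<phi>_deriv] sin)
    show "continuous_on {0..pi / 2} \<Phi>"
      by (rule DERIV_continuous_on) (rule has_field_derivative_at_within[OF \<Phi>_deriv])
    fix t :: real assume t: "0 < t" "t < pi / 2"
    show "(\<phi> has_vector_derivative ?D t) (at t)"
      using \<phi>_deriv[OF sin] t by (simp add: has_real_derivative_iff_has_vector_derivative)
    show "(\<Phi> has_vector_derivative (cos t * (\<Sum>i\<in>UNIV. bnd i (sin t)))) (at t)"
      using \<Phi>_deriv by (simp add: has_real_derivative_iff_has_vector_derivative)
    have "cos t \<ge> 0" using t by (intro cos_ge_zero) auto
    then show "norm (?D t) \<le> cos t * (\<Sum>i\<in>UNIV. bnd i (sin t))"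
      unfolding real_norm_def abs_mult using t
      by (intro mult_mono order_trans[OF sum_abs] sum_mono stein_increment_bound sin) auto
  qed simp
  moreover have "\<Phi> 0 = 0" by (simp add: \<Phi>_def)
  ultimately show ?thesis unfolding \<phi>_ends by simp
qed

end

theorem theorem2:
  fixes M :: "'a measure" and N :: "'b measure"
    and W W' G :: "'a \<Rightarrow> real^'d::finite" and Z :: "'b \<Rightarrow> real^'d"
    and h :: "real^'d \<Rightarrow> real" and p :: nat
  assumes "p \<ge> 1"
    and "prob_space M"
    and "W \<in> borel_measurable M" and "W' \<in> borel_measurable M" and "G \<in> borel_measurable M"
    and "stein_coupling M W W' G"
    and "\<And>j. integrable M (\<lambda>x. (W x $ j)\<^sup>2)"
    and "centred_gaussian N Z (cov_matrix M W)"
    and "k_times_differentiable (p + 2) h"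
    and "\<And>\<beta>. 2 \<le> mi_abs \<beta> \<Longrightarrow> mi_abs \<beta> \<le> p + 2 \<Longrightarrow> bounded (range (pderiv_mi \<beta> h))"
    and "\<And>i \<alpha>. 1 \<le> mi_abs \<alpha> \<Longrightarrow> mi_abs \<alpha> \<le> p + 1 \<Longrightarrow>
           integrable M (\<lambda>x. G x $ i * mi_pow (W' x - W x) \<alpha>)"
    and "\<And>i \<alpha>. 1 \<le> mi_abs \<alpha> \<Longrightarrow> mi_abs \<alpha> \<le> p \<Longrightarrow>
           integrable M (\<lambda>x. (cond_exp_given M W (\<lambda>y. G y $ i * mi_pow (W' y - W y) \<alpha>) x)\<^sup>2)"
  shows "\<bar>(\<integral>x. h (W x) \<partial>M) - (\<integral>z. h (Z z) \<partial>N)\<bar> \<le>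
    (\<Sum>i\<in>UNIV.
        (\<Sum>\<alpha>\<in>{\<alpha>. 1 \<le> mi_abs \<alpha> \<and> mi_abs \<alpha> \<le> p}.
           sup_norm_mi h (add_unit_mi \<alpha> i) / ((real (mi_abs \<alpha>) + 1) * mi_fact \<alpha>)
           * sqrt (Var M (cond_exp_given M W (\<lambda>x. G x $ i * mi_pow (W' x - W x) \<alpha>))))
      + (\<Sum>\<alpha>\<in>{\<alpha>. 2 \<le> mi_abs \<alpha> \<and> mi_abs \<alpha> \<le> p}.
           sup_norm_mi h (add_unit_mi \<alpha> i) / ((real (mi_abs \<alpha>) + 1) * mi_fact \<alpha>)
           * \<bar>\<integral>x. G x $ i * mi_pow (W' x - W x) \<alpha> \<partial>M\<bar>)
      + (\<Sum>\<alpha>\<in>{\<alpha>. mi_abs \<alpha> = p + 1}.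
           sup_norm_mi h (add_unit_mi \<alpha> i) / ((real p + 2) * mi_fact \<alpha>)
           * (\<integral>x. \<bar>G x $ i * mi_pow (W' x - W x) \<alpha>\<bar> \<partial>M)))"
proof -
  interpret stein_pair M W W' G
    using assms by (simp add: stein_pair_def stein_pair_axioms_def)
  interpret stein_interpolation M W W' G N Z h p
    by unfold_locales (use assms in auto)
  \<comment> \<open>At \<open>pi / 2\<close> the sine is 1, so all its powers in \<Phi>
    disappear.\<close>
  show ?thesis
    using interpolation_bound by (simp add: \<Phi>_def)
qed

end
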